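(* For any integers $1\le h<k\le n$, the signed $k,h$-equal partition lattice $\Pi^B_{n,k,h}$ is comodernistic.
   Context: A sign pattern on a set is an assignment of $+$ or $-$ to each element, considered up to reversing all signs simultaneously. A signed partition of $\{0,1,\dots,n\}$ is a set partition together with a sign pattern on each block not containing $0$ (the block containing $0$ is the zero block; the others are signed blocks). The signed partition lattice $\Pi^B_n$ consists of all signed partitions; its cover relations are: merging two signed blocks and choosing one of the two sign patterns on the union compatible with the patterns on the two blocks, or merging a signed block into the zero block (forgetting its sign pattern). $\Pi^B_{n,k,h}$ is the subposet of $\Pi^B_n$ of signed partitions whose non-singleton signed blocks have size at least $k$ and whose zero block is either a singleton or has size at least $h+1$. An element $m$ of a lattice $L$ is left-modular if $(x\vee m)\wedge y=x\vee(m\wedge y)$ for all $x<y$; a lattice is comodernistic if every interval $[u,v]$ has a coatom that is left-modular in $[u,v]$. *)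

theory Defs
  imports "HOL-Algebra.Lattice" "HOL-Library.Disjoint_Sets" "HOL-Library.FuncSet"
begin

section \<open>Comodernistic lattices\<close>

definition interval :: "('a, 'b) gorder_scheme \<Rightarrow> 'a \<Rightarrow> 'a \<Rightarrow> ('a, 'b) gorder_scheme" where
  "interval L u v = L\<lparr>carrier := \<lbrace>u..v\<rbrace>\<^bsub>L\<^esub>\<rparr>"

definition left_modular :: "('a, 'b) gorder_scheme \<Rightarrow> 'a \<Rightarrow> bool" where
  "left_modular L m \<longleftrightarrow> m \<in> carrier L \<and>
     (\<forall>x \<in> carrier L. \<forall>y \<in> carrier L. x \<sqsubset>\<^bsub>L\<^esub> y \<longrightarrow>
        (x \<squnion>\<^bsub>L\<^esub> m) \<sqinter>\<^bsub>L\<^esub> y = x \<squnion>\<^bsub>L\<^esub> (m \<sqinter>\<^bsub>L\<^esub> y))"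

definition coatom :: "('a, 'b) gorder_scheme \<Rightarrow> 'a \<Rightarrow> bool" where
  "coatom L m \<longleftrightarrow> m \<in> carrier L \<and>
     (\<exists>t. greatest L t (carrier L) \<and> m \<sqsubset>\<^bsub>L\<^esub> t \<and>
        \<not> (\<exists>z \<in> carrier L. m \<sqsubset>\<^bsub>L\<^esub> z \<and> z \<sqsubset>\<^bsub>L\<^esub> t))"

text \<open>One-element intervals have no coatom, so only intervals with $u < v$ are considered.\<close>

definition comodernistic :: "('a, 'b) gorder_scheme \<Rightarrow> bool" where
  "comodernistic L \<longleftrightarrow> lattice L \<and>
     (\<forall>u \<in> carrier L. \<forall>v \<in> carrier L. u \<sqsubset>\<^bsub>L\<^esub> v \<longrightarrow>
        (\<exists>m. coatom (interval L u v) m \<and> left_modular (interval L u v) m))"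


section \<open>Signed partitions\<close>

text \<open>
  Signs are booleans, and a sign assignment on a block is an extensional function on it.
  A sign pattern is the set consisting of an assignment and its reversal.
\<close>

definition sign_patterns :: "nat set \<Rightarrow> (nat \<Rightarrow> bool) set set" where
  "sign_patterns B = (\<lambda>f. {f, restrict (\<lambda>i. \<not> f i) B}) ` (B \<rightarrow>\<^sub>E UNIV)"

definition restrict_pattern :: "(nat \<Rightarrow> bool) set \<Rightarrow> nat set \<Rightarrow> (nat \<Rightarrow> bool) set" where
  "restrict_pattern p B = (\<lambda>f. restrict f B) ` p"

definition signed_blocks :: "nat set set \<Rightarrow> nat set set" where
  "signed_blocks P = {B \<in> P. 0 \<notin> B}"

text \<open>
  The second component assigns a sign pattern to every signed block; it is extensional
  (\<open>undefined\<close> off the signed blocks), so that equality of signed partitions is equality of pairs.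
\<close>

type_synonym signed_partition = "nat set set \<times> (nat set \<Rightarrow> (nat \<Rightarrow> bool) set)"

definition signed_partitions :: "nat \<Rightarrow> signed_partition set" where
  "signed_partitions n =
     (SIGMA P : {P. partition_on {0..n} P}. \<Pi>\<^sub>E B \<in> signed_blocks P. sign_patterns B)"

inductive signed_cover :: "signed_partition \<Rightarrow> signed_partition \<Rightarrow> bool" where
  merge_signed:
    "\<lbrakk>A \<in> signed_blocks P; B \<in> signed_blocks P; A \<noteq> B;
      p \<in> sign_patterns (A \<union> B); restrict_pattern p A = \<sigma> A; restrict_pattern p B = \<sigma> B;
      Q = insert (A \<union> B) (P - {A, B})\<rbrakk>
     \<Longrightarrow> signed_cover (P, \<sigma>) (Q, restrict (\<sigma>(A \<union> B := p)) (signed_blocks Q))"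
| merge_zero:
    "\<lbrakk>Z \<in> P; 0 \<in> Z; A \<in> signed_blocks P; Q = insert (Z \<union> A) (P - {Z, A})\<rbrakk>
     \<Longrightarrow> signed_cover (P, \<sigma>) (Q, restrict \<sigma> (signed_blocks Q))"

definition signed_partition_lattice :: "nat \<Rightarrow> signed_partition gorder" where
  "signed_partition_lattice n =
     \<lparr>carrier = signed_partitions n, eq = (=), le = signed_cover\<^sup>*\<^sup>*\<rparr>"

definition signed_equal_partition_lattice :: "nat \<Rightarrow> nat \<Rightarrow> nat \<Rightarrow> signed_partition gorder" where
  "signed_equal_partition_lattice n k h =
     (signed_partition_lattice n)
       \<lparr>carrier := {(P, \<sigma>) \<in> signed_partitions n.
          (\<forall>B \<in> signed_blocks P. card B = 1 \<or> k \<le> card B) \<and>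
          (\<forall>Z \<in> P. 0 \<in> Z \<longrightarrow> card Z = 1 \<or> h + 1 \<le> card Z)}\<rparr>"

text \<open>
  Chains of covers starting in a signed partition of \<open>{0..n}\<close> consist of signed partitions of
  \<open>{0..n}\<close>, so the order above is the one generated by the covers inside the carrier.
\<close>

lemma partition_on_merge:
  assumes "partition_on S P" "A \<in> P" "B \<in> P"
  shows "partition_on S (insert (A \<union> B) (P - {A, B}))"
proof -
  have disj: "C \<inter> D = {}" if "C \<in> P" "D \<in> P" "C \<noteq> D" for C D
    using assms(1) that by (auto simp: partition_on_def disjoint_def)
  have "disjnt (A \<union> B) C" if "C \<in> P - {A, B}" for C
    using that disj[of A C] disj[of B C] assms(2,3) by (auto simp: disjnt_def)
  moreover have "disjoint (P - {A, B})"
    using disj by (auto simp: disjoint_def)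
  ultimately have "disjoint (insert (A \<union> B) (P - {A, B}))"
    by (auto simp: pairwise_insert disjnt_sym)
  moreover have "\<Union>(insert (A \<union> B) (P - {A, B})) = \<Union>P"
    using assms(2,3) by auto
  ultimately show ?thesis
    using assms by (auto simp: partition_on_def)
qed

lemma signed_cover_closed:
  assumes "signed_cover x y" "x \<in> signed_partitions n"
  shows "y \<in> signed_partitions n"
  using assms
proof (induction rule: signed_cover.induct)
  case (merge_signed A P B p \<sigma> Q)
  then have P: "partition_on {0..n} P" and \<sigma>: "\<And>C. C \<in> signed_blocks P \<Longrightarrow> \<sigma> C \<in> sign_patterns C"
    by (auto simp: signed_partitions_def)
  have "A \<in> P" "B \<in> P" using merge_signed by (auto simp: signed_blocks_def)
  with P have "partition_on {0..n} Q"
    unfolding merge_signed(7) by (simp add: partition_on_merge)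
  moreover have "(\<sigma>(A \<union> B := p)) C \<in> sign_patterns C" if "C \<in> signed_blocks Q" for C
    using that \<sigma> merge_signed(4,7) by (auto simp: signed_blocks_def)
  ultimately show ?case by (auto simp: signed_partitions_def)
next
  case (merge_zero Z P A Q \<sigma>)
  then have P: "partition_on {0..n} P" and \<sigma>: "\<And>C. C \<in> signed_blocks P \<Longrightarrow> \<sigma> C \<in> sign_patterns C"
    by (auto simp: signed_partitions_def)
  have "A \<in> P" using merge_zero by (auto simp: signed_blocks_def)
  with P \<open>Z \<in> P\<close> have "partition_on {0..n} Q"
    unfolding merge_zero(4) by (simp add: partition_on_merge)
  moreover have "\<sigma> C \<in> sign_patterns C" if "C \<in> signed_blocks Q" for C
    using that \<sigma> merge_zero(2,4) by (auto simp: signed_blocks_def)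
  ultimately show ?case by (auto simp: signed_partitions_def)
qed

end

theory Submission
  imports Defs
begin

text \<open>
  A signed partition is encoded by the set of triples \<open>(s, i, j)\<close> such that \<open>i\<close> and \<open>j\<close> lie in
  a common block and have relative sign \<open>s\<close> there; in the zero block both relative signs occur.
  Refinement then becomes inclusion, and the relations of the $k,h$-equal partitions have meets:
  intersect, then break every block that is too small into singletons (rounding down).

  Given $u < v$, choose a signed block $C$ of $u$ that is not a block of $v$, a singleton if
  possible, and let $m$ be obtained from $v$ by splitting off $C$ and rounding down. For $y$ in
  $[u,v]$ one has $y \not\le m$ iff $C$ is not a block of $y$; splitting $C$ off $y$ and rounding
  down yields an $s \le m, y$ such that $y$ is the only element of $[s,y]$ not below $m$. The case
  $y = v$ makes $m$ a coatom, the general case makes it left-modular.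
\<close>

section \<open>A criterion for comodernistic lattices\<close>

text \<open>Joins and meets taken in \<open>L\<close> stay between \<open>u\<close> and
  \<open>v\<close>, so they also serve in the interval. The criterion below can then be applied to
  \<open>interval L u v\<close> itself, whose own joins and meets occur in
  \<open>left_modular\<close>.\<close>

lemma lattice_interval:
  assumes "lattice L" and u: "u \<in> carrier L" and v: "v \<in> carrier L"
  shows "lattice (interval L u v)"
proof -
  interpret L: lattice L by fact
  let ?I = "interval L u v"
  have carr: "carrier ?I = {x \<in> carrier L. u \<sqsubseteq>\<^bsub>L\<^esub> x \<and> x \<sqsubseteq>\<^bsub>L\<^esub> v}"
    and le: "le ?I = le L" and eq: "eq ?I = eq L"
    by (simp_all add: interval_def at_least_at_most_def)
  have "weak_partial_order ?I"
    unfolding interval_def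
    by (rule weak_partial_order_subset[OF L.weak_partial_order_axioms])
      (auto simp: at_least_at_most_def)
  then have "partial_order ?I"
    by (simp add: partial_order_def partial_order_axioms_def eq L.eq_is_equal)
  moreover have "\<exists>s. least ?I s (Upper ?I {x, y})"
    if x: "x \<in> carrier ?I" and y: "y \<in> carrier ?I" for x y
  proof (rule exI[of _ "x \<squnion>\<^bsub>L\<^esub> y"], rule least_UpperI)
    have c: "x \<in> carrier L" "y \<in> carrier L" "u \<sqsubseteq>\<^bsub>L\<^esub> x" "x \<sqsubseteq>\<^bsub>L\<^esub> v" "y \<sqsubseteq>\<^bsub>L\<^esub> v"
      using x y carr by auto
    show "x \<squnion>\<^bsub>L\<^esub> y \<in> carrier ?I"
      using c u v L.le_trans[OF c(3) L.join_left[OF c(1,2)]] by (simp add: carr L.join_le)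
    show "z \<sqsubseteq>\<^bsub>?I\<^esub> x \<squnion>\<^bsub>L\<^esub> y" if "z \<in> {x, y}" for z
      using that c L.join_left L.join_right by (auto simp: le)
    show "x \<squnion>\<^bsub>L\<^esub> y \<sqsubseteq>\<^bsub>?I\<^esub> z" if "z \<in> Upper ?I {x, y}" for z
      using that x y c by (auto simp: le Upper_def carr intro: L.join_le)
    show "{x, y} \<subseteq> carrier ?I" using x y by simp
  qed
  moreover have "\<exists>s. greatest ?I s (Lower ?I {x, y})"
    if x: "x \<in> carrier ?I" and y: "y \<in> carrier ?I" for x y
  proof (rule exI[of _ "x \<sqinter>\<^bsub>L\<^esub> y"], rule greatest_LowerI)
    have c: "x \<in> carrier L" "y \<in> carrier L" "x \<sqsubseteq>\<^bsub>L\<^esub> v" "u \<sqsubseteq>\<^bsub>L\<^esub> x" "u \<sqsubseteq>\<^bsub>L\<^esub> y"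
      using x y carr by auto
    show "x \<sqinter>\<^bsub>L\<^esub> y \<in> carrier ?I"
      using c u v L.le_trans[OF L.meet_left[OF c(1,2)] c(3)] by (simp add: carr L.meet_le)
    show "x \<sqinter>\<^bsub>L\<^esub> y \<sqsubseteq>\<^bsub>?I\<^esub> z" if "z \<in> {x, y}" for z
      using that c L.meet_left L.meet_right by (auto simp: le)
    show "z \<sqsubseteq>\<^bsub>?I\<^esub> x \<sqinter>\<^bsub>L\<^esub> y" if "z \<in> Lower ?I {x, y}" for z
      using that x y c by (auto simp: le Lower_def carr intro: L.meet_le)
    show "{x, y} \<subseteq> carrier ?I" using x y by simp
  qed
  ultimately show ?thesis
    by (simp add: lattice_def upper_semilattice_def lower_semilattice_def
        upper_semilattice_axioms_def lower_semilattice_axioms_def)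
qed

text \<open>For \<open>y = t\<close>, the property \<open>crit\<close> leaves no element strictly
  between \<open>m\<close> and the top. In the modular law, if \<open>x\<close> lies below
  \<open>m\<close>, both sides are the meet of \<open>m\<close> and \<open>y\<close>. Otherwise the
  left side is \<open>y\<close>, and the right side lies in $[s,y]$ but not below \<open>m\<close>,
  so it is \<open>y\<close> too.\<close>

lemma (in lattice) coatom_left_modularI:
  assumes t: "greatest L t (carrier L)" and m: "m \<in> carrier L" "m \<noteq> t"
    and crit: "\<And>y. \<lbrakk>y \<in> carrier L; \<not> y \<sqsubseteq> m\<rbrakk> \<Longrightarrow> \<exists>s \<in> carrier L. s \<sqsubseteq> m \<and> s \<sqsubseteq> y \<and>
      (\<forall>w \<in> carrier L. s \<sqsubseteq> w \<longrightarrow> w \<sqsubseteq> y \<longrightarrow> \<not> w \<sqsubseteq> m \<longrightarrow> w = y)"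
  shows "coatom L m" "left_modular L m"
proof -
  have tc: "t \<in> carrier L" and tt: "\<And>x. x \<in> carrier L \<Longrightarrow> x \<sqsubseteq> t"
    using t by (auto simp: greatest_def)
  have nt: "\<not> t \<sqsubseteq> m" using m tt[of m] tc le_antisym by blast
  \<comment> \<open>The element \<open>s\<close> that \<open>crit\<close> yields for the top lies
    below \<open>m\<close>, hence below \<open>w\<close>.\<close>
  have above: "w = t" if w: "w \<in> carrier L" "m \<sqsubseteq> w" "\<not> w \<sqsubseteq> m" for w
    using crit[OF tc nt] w tt m(1) le_trans by blast
  show "coatom L m"
    unfolding coatom_def
  proof (intro conjI exI[of _ t])
    show "\<not> (\<exists>z\<in>carrier L. m \<sqsubset> z \<and> z \<sqsubset> t)"
      using above m(1) by (auto simp: lless_def eq_is_equal)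
  qed (use m tt t in \<open>auto simp: lless_def eq_is_equal\<close>)
  show "left_modular L m"
    unfolding left_modular_def
  proof (intro conjI ballI impI)
    fix x y assume x: "x \<in> carrier L" and y: "y \<in> carrier L" and "x \<sqsubset> y"
    then have xy: "x \<sqsubseteq> y" by (simp add: lless_def)
    show "(x \<squnion> m) \<sqinter> y = x \<squnion> (m \<sqinter> y)"
    proof (cases "x \<sqsubseteq> m")
      case True
      then have "x \<squnion> m = m" using x m(1) le_iff_meet by blast
      moreover have "x \<squnion> (m \<sqinter> y) = m \<sqinter> y"
        using le_iff_meet[OF x meet_closed[OF m(1) y]] meet_le[OF True xy m(1) y x] by blast
      ultimately show ?thesis by simp
    next
      case False
      have my: "m \<sqinter> y \<in> carrier L" using m(1) y by simp
      have "\<not> x \<squnion> m \<sqsubseteq> m" using False join_left[OF x m(1)] x m(1) le_trans by (metis join_closed)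
      then have "x \<squnion> m = t" using above join_right[OF x m(1)] x m(1) by simp
      then have lhs: "(x \<squnion> m) \<sqinter> y = y"
        using le_iff_join[OF y tc] tt[OF y] meet_comm[of L y t] by simp
      have "\<not> y \<sqsubseteq> m" using False xy x y m(1) le_trans by blast
      from crit[OF y this] obtain s where s: "s \<in> carrier L" "s \<sqsubseteq> m" "s \<sqsubseteq> y"
        and only: "\<And>w. \<lbrakk>w \<in> carrier L; s \<sqsubseteq> w; w \<sqsubseteq> y; \<not> w \<sqsubseteq> m\<rbrakk> \<Longrightarrow> w = y"
        by blast
      let ?w = "x \<squnion> (m \<sqinter> y)"
      have w: "?w \<in> carrier L" using x my by simp
      have "?w = y"
      proof (rule only[OF w])
        show "s \<sqsubseteq> ?w"
          using le_trans[OF meet_le[OF s(2,3) m(1) y s(1)] join_right[OF x my] s(1) my w] .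
        show "?w \<sqsubseteq> y" using join_le[OF xy meet_right[OF m(1) y] x my y] .
        show "\<not> ?w \<sqsubseteq> m" using False le_trans[OF join_left[OF x my] _ x w m(1)] by blast
      qed
      then show ?thesis using lhs by simp
    qed
  qed (fact m)
qed

text \<open>Carries the criterion to an order isomorphic to inclusion on a family \<open>G\<close>.
  The assumption \<open>inf\<close> asks for a largest member inside the intersection, not for the
  intersection itself, because meets of $k,h$-equal partitions arise by rounding down.\<close>

lemma comodernistic_set_family:
  fixes L :: "('a, 'b) gorder_scheme" and f :: "'a \<Rightarrow> 'c set" and G :: "'c set set"
  assumes eq: "eq L = (=)" and bij: "bij_betw f (carrier L) G"
    and le: "\<And>x y. \<lbrakk>x \<in> carrier L; y \<in> carrier L\<rbrakk> \<Longrightarrow> x \<sqsubseteq>\<^bsub>L\<^esub> y \<longleftrightarrow> f x \<subseteq> f y"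
    and top: "T \<in> G" "\<And>S. S \<in> G \<Longrightarrow> S \<subseteq> T"
    and inf: "\<And>A. \<lbrakk>A \<subseteq> G; A \<noteq> {}\<rbrakk> \<Longrightarrow>
      \<exists>M \<in> G. M \<subseteq> \<Inter>A \<and> (\<forall>S \<in> G. S \<subseteq> \<Inter>A \<longrightarrow> S \<subseteq> M)"
    and crit: "\<And>u v. \<lbrakk>u \<in> G; v \<in> G; u \<subset> v\<rbrakk> \<Longrightarrow>
      \<exists>m \<in> G. u \<subseteq> m \<and> m \<subset> v \<and> (\<forall>y \<in> G. u \<subseteq> y \<longrightarrow> y \<subseteq> v \<longrightarrow> \<not> y \<subseteq> m \<longrightarrow>
        (\<exists>s \<in> G. u \<subseteq> s \<and> s \<subseteq> m \<and> s \<subseteq> y \<and>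
          (\<forall>w \<in> G. s \<subseteq> w \<longrightarrow> w \<subseteq> y \<longrightarrow> \<not> w \<subseteq> m \<longrightarrow> w = y)))"
  shows "comodernistic L"
proof -
  have fG: "f x \<in> G" if "x \<in> carrier L" for x using bij that by (auto simp: bij_betw_def)
  have inj: "x = y" if "x \<in> carrier L" "y \<in> carrier L" "f x = f y" for x y
    using bij that by (auto simp: bij_betw_def inj_on_def)
  have surj: "\<exists>x \<in> carrier L. f x = S" if "S \<in> G" for S
    using bij that by (auto simp: bij_betw_def)
  have po: "partial_order L"
  proof
    fix x y z
    assume "x \<sqsubseteq>\<^bsub>L\<^esub> y" "y \<sqsubseteq>\<^bsub>L\<^esub> z" "x \<in> carrier L" "y \<in> carrier L" "z \<in> carrier L"
    then show "x \<sqsubseteq>\<^bsub>L\<^esub> z" using le by (metis subset_trans)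
  qed (use le inj in \<open>auto simp: eq\<close>)
  have glb: "\<exists>s. greatest L s (Lower L A)" if A: "A \<subseteq> carrier L" "A \<noteq> {}" for A
  proof -
    have "f ` A \<subseteq> G" "f ` A \<noteq> {}" using A fG by auto
    from inf[OF this] obtain M where M: "M \<in> G" "M \<subseteq> \<Inter>(f ` A)"
      "\<forall>S \<in> G. S \<subseteq> \<Inter>(f ` A) \<longrightarrow> S \<subseteq> M" by (elim bexE conjE)
    from surj[OF M(1)] obtain s where s: "s \<in> carrier L" "f s = M" by blast
    have "greatest L s (Lower L A)"
    proof (rule greatest_LowerI)
      show "s \<sqsubseteq>\<^bsub>L\<^esub> x" if "x \<in> A" for x using that A s M(2) le[of s x] by auto
      show "y \<sqsubseteq>\<^bsub>L\<^esub> s" if "y \<in> Lower L A" for y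
      proof -
        have y: "y \<in> carrier L" "\<And>x. x \<in> A \<Longrightarrow> y \<sqsubseteq>\<^bsub>L\<^esub> x"
          using that A by (auto simp: Lower_def)
        have "f y \<subseteq> f x" if "x \<in> A" for x
          using y(2)[OF that] le[OF y(1), of x] that A(1) by auto
        then have "f y \<subseteq> \<Inter>(f ` A)" by (rule INT_greatest)
        then show ?thesis using M(3) fG[OF y(1)] le[OF y(1) s(1)] s(2) by simp
      qed
    qed (use A s in auto)
    then show ?thesis by blast
  qed
  from surj[OF top(1)] obtain t where t: "t \<in> carrier L" "f t = T" by blast
  have lub: "\<exists>s. least L s (Upper L {x, y})" if x: "x \<in> carrier L" and y: "y \<in> carrier L" for x y
  proof -
    \<comment> \<open>The join is the meet of all upper bounds; the top makes this set nonempty, as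
      \<open>glb\<close> requires.\<close>
    have "t \<in> Upper L {x, y}" using t x y top(2) fG le by (auto simp: Upper_def)
    then obtain s where s: "greatest L s (Lower L (Upper L {x, y}))"
      using glb[of "Upper L {x, y}"] by auto
    have "least L s (Upper L {x, y})"
    proof (rule least_UpperI)
      show "z \<sqsubseteq>\<^bsub>L\<^esub> s" if "z \<in> {x, y}" for z
        using s that x y by (auto simp: greatest_def Lower_def Upper_def)
      show "s \<sqsubseteq>\<^bsub>L\<^esub> z" if "z \<in> Upper L {x, y}" for z
        using s that x y by (auto simp: greatest_def Lower_def)
    qed (use s x y in auto)
    then show ?thesis by blast
  qed
  have lat: "lattice L"
    by (simp add: lattice_def upper_semilattice_def lower_semilattice_def po
        upper_semilattice_axioms_def lower_semilattice_axioms_def lub glb)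
  have "\<exists>m. coatom (interval L u v) m \<and> left_modular (interval L u v) m"
    if u: "u \<in> carrier L" and v: "v \<in> carrier L" and uv: "u \<sqsubset>\<^bsub>L\<^esub> v" for u v
  proof -
    interpret I: lattice "interval L u v" by (rule lattice_interval[OF lat u v])
    have carr: "x \<in> carrier (interval L u v) \<longleftrightarrow> x \<in> carrier L \<and> f u \<subseteq> f x \<and> f x \<subseteq> f v" for x
      using le u v by (auto simp: interval_def at_least_at_most_def)
    have leI: "x \<sqsubseteq>\<^bsub>interval L u v\<^esub> y \<longleftrightarrow> f x \<subseteq> f y" if "x \<in> carrier L" "y \<in> carrier L" for x y
      using le that by (auto simp: interval_def)
    have "f u \<subset> f v" using uv u v le inj[of u v] by (auto simp: lless_def eq)
    from crit[OF fG[OF u] fG[OF v] this] obtain M where M: "M \<in> G" "f u \<subseteq> M" "M \<subset> f v"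
      and cM: "\<forall>y \<in> G. f u \<subseteq> y \<longrightarrow> y \<subseteq> f v \<longrightarrow> \<not> y \<subseteq> M \<longrightarrow>
        (\<exists>s \<in> G. f u \<subseteq> s \<and> s \<subseteq> M \<and> s \<subseteq> y \<and>
          (\<forall>w \<in> G. s \<subseteq> w \<longrightarrow> w \<subseteq> y \<longrightarrow> \<not> w \<subseteq> M \<longrightarrow> w = y))"
      by (elim bexE conjE)
    from surj[OF M(1)] obtain m where mM: "m \<in> carrier L" "f m = M" by blast
    then have m: "m \<in> carrier L" "f u \<subseteq> f m" "f m \<subset> f v"
      and c: "\<And>y. \<lbrakk>y \<in> G; f u \<subseteq> y; y \<subseteq> f v; \<not> y \<subseteq> f m\<rbrakk> \<Longrightarrow>
        (\<exists>s \<in> G. f u \<subseteq> s \<and> s \<subseteq> f m \<and> s \<subseteq> y \<and>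
          (\<forall>w \<in> G. s \<subseteq> w \<longrightarrow> w \<subseteq> y \<longrightarrow> \<not> w \<subseteq> f m \<longrightarrow> w = y))"
      using M cM by simp_all
    have gr: "greatest (interval L u v) v (carrier (interval L u v))"
      using \<open>f u \<subset> f v\<close> v by (auto simp: greatest_def carr leI)
    have mc: "m \<in> carrier (interval L u v)" "m \<noteq> v"
      using m by (auto simp: carr)
    have "\<exists>s\<in>carrier (interval L u v). s \<sqsubseteq>\<^bsub>interval L u v\<^esub> m \<and> s \<sqsubseteq>\<^bsub>interval L u v\<^esub> y \<and>
      (\<forall>w\<in>carrier (interval L u v). s \<sqsubseteq>\<^bsub>interval L u v\<^esub> w \<longrightarrow> w \<sqsubseteq>\<^bsub>interval L u v\<^esub> y \<longrightarrow>
        \<not> w \<sqsubseteq>\<^bsub>interval L u v\<^esub> m \<longrightarrow> w = y)"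
      if y: "y \<in> carrier (interval L u v)" "\<not> y \<sqsubseteq>\<^bsub>interval L u v\<^esub> m" for y
    proof -
      have yG: "f y \<in> G" "f u \<subseteq> f y" "f y \<subseteq> f v" "\<not> f y \<subseteq> f m"
        using y fG m(1) by (auto simp: carr leI)
      from c[OF yG] obtain S where S: "S \<in> G" "f u \<subseteq> S" "S \<subseteq> f m" "S \<subseteq> f y"
        "\<forall>w \<in> G. S \<subseteq> w \<longrightarrow> w \<subseteq> f y \<longrightarrow> \<not> w \<subseteq> f m \<longrightarrow> w = f y"
        by (elim bexE conjE)
      from surj[OF S(1)] obtain s where s: "s \<in> carrier L" "f s = S" by blast
      have sc: "s \<in> carrier (interval L u v)" using s S yG by (simp add: carr)
      have yc: "y \<in> carrier L" using y by (simp add: carr)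
      have "w = y" if "w \<in> carrier (interval L u v)" "s \<sqsubseteq>\<^bsub>interval L u v\<^esub> w"
        "w \<sqsubseteq>\<^bsub>interval L u v\<^esub> y" "\<not> w \<sqsubseteq>\<^bsub>interval L u v\<^esub> m" for w
        using that S(5) s yc m(1) fG[of w] inj[of w y] by (simp add: carr leI)
      then show ?thesis using sc s S yc m(1) by (intro bexI[OF _ sc]) (simp add: leI)
    qed
    then have "coatom (interval L u v) m \<and> left_modular (interval L u v) m"
      using I.coatom_left_modularI[OF gr mc] by blast
    then show ?thesis by blast
  qed
  with lat show ?thesis by (auto simp: comodernistic_def)
qed

section \<open>Signed equivalence relations\<close>

type_synonym signed_rel = "(bool \<times> nat \<times> nat) set"

text \<open>Signs multiply by \<open>s = t\<close>, with \<open>True\<close> as unit. The triple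
  \<open>(False, 0, 0)\<close> makes the block of \<open>0\<close> carry both signs, and the last
  clause allows this to no other block.\<close>

definition signed_equiv :: "nat \<Rightarrow> signed_rel \<Rightarrow> bool" where
  "signed_equiv n R \<longleftrightarrow>
     (\<forall>s i j. (s, i, j) \<in> R \<longrightarrow> i \<le> n \<and> j \<le> n) \<and>
     (\<forall>i\<le>n. (True, i, i) \<in> R) \<and>
     (\<forall>s i j. (s, i, j) \<in> R \<longrightarrow> (s, j, i) \<in> R) \<and>
     (\<forall>s t i j l. (s, i, j) \<in> R \<longrightarrow> (t, j, l) \<in> R \<longrightarrow> (s = t, i, l) \<in> R) \<and>
     (False, 0, 0) \<in> R \<and>
     (\<forall>i. (False, i, i) \<in> R \<longrightarrow> (True, i, 0) \<in> R)"

definition block :: "signed_rel \<Rightarrow> nat \<Rightarrow> nat set" where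
  "block R i = {j. \<exists>s. (s, i, j) \<in> R}"

context
  fixes n :: nat and R :: signed_rel
  assumes R: "signed_equiv n R"
begin

lemma signed_equiv_bound: "(s, i, j) \<in> R \<Longrightarrow> i \<le> n" "(s, i, j) \<in> R \<Longrightarrow> j \<le> n"
  using R by (auto simp: signed_equiv_def)

lemma signed_equiv_refl: "i \<le> n \<Longrightarrow> (True, i, i) \<in> R"
  using R by (auto simp: signed_equiv_def)

lemma signed_equiv_sym: "(s, i, j) \<in> R \<Longrightarrow> (s, j, i) \<in> R"
  using R by (auto simp: signed_equiv_def)

lemma signed_equiv_trans: "(s, i, j) \<in> R \<Longrightarrow> (t, j, l) \<in> R \<Longrightarrow> (s = t, i, l) \<in> R"
  using R by (auto simp: signed_equiv_def)

lemma signed_equiv_zero: "(False, 0, 0) \<in> R"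
  using R by (auto simp: signed_equiv_def)

lemma signed_equiv_zeroD: "(False, i, i) \<in> R \<Longrightarrow> (True, i, 0) \<in> R"
  using R by (auto simp: signed_equiv_def)

lemma block_self: "i \<le> n \<Longrightarrow> i \<in> block R i"
  using signed_equiv_refl by (auto simp: block_def)

lemma block_sym: "j \<in> block R i \<Longrightarrow> i \<in> block R j"
  using signed_equiv_sym by (auto simp: block_def)

lemma block_eq: "j \<in> block R i \<Longrightarrow> block R j = block R i"
  unfolding block_def using signed_equiv_sym signed_equiv_trans by blast

lemma block_subset: "block R i \<subseteq> {0..n}"
  using signed_equiv_bound by (auto simp: block_def)

lemma finite_block: "finite (block R i)"
  using block_subset finite_subset by blast

text \<open>Going from \<open>i\<close> to \<open>0\<close>, around the loop
  \<open>(False, 0, 0)\<close> and back cancels the sign \<open>s\<close> and leaves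
  \<open>False\<close>.\<close>

lemma zero_block_iff: "(False, i, i) \<in> R \<longleftrightarrow> 0 \<in> block R i"
proof
  assume "(False, i, i) \<in> R"
  then show "0 \<in> block R i" using signed_equiv_zeroD by (auto simp: block_def)
next
  assume "0 \<in> block R i"
  then obtain s where s: "(s, i, 0) \<in> R" by (auto simp: block_def)
  from signed_equiv_trans[OF signed_equiv_trans[OF s signed_equiv_zero] signed_equiv_sym[OF s]]
  show "(False, i, i) \<in> R" by (cases s) auto
qed

text \<open>Composing with the loop \<open>(False, i, i)\<close> flips a sign.\<close>

lemma both_signs: "(s, i, j) \<in> R \<Longrightarrow> 0 \<in> block R i \<Longrightarrow> (t, i, j) \<in> R"
  using signed_equiv_trans[of False i i s j] zero_block_iff[of i] by (cases s; cases t) auto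

text \<open>Two different signs would compose to the loop \<open>(False, i, i)\<close>, which exists
  in the zero block only.\<close>

lemma signs_unique: "(s, i, j) \<in> R \<Longrightarrow> (t, i, j) \<in> R \<Longrightarrow> 0 \<notin> block R i \<Longrightarrow> s = t"
  using signed_equiv_trans[of s i j t i] signed_equiv_sym[of t i j] zero_block_iff[of i] by (cases s; cases t) auto

end

lemma block_mono: "R \<subseteq> S \<Longrightarrow> block R i \<subseteq> block S i"
  by (auto simp: block_def)

text \<open>Some sign \<open>t\<close> relates \<open>i\<close> and \<open>j\<close> in
  \<open>W\<close>. In the zero block both signs then do, and elsewhere \<open>Y\<close> has room
  for one sign only. So comparable relations can be compared block by block.\<close>

lemma signed_equiv_block_eqD:
  assumes W: "signed_equiv n W" and Y: "signed_equiv n Y" and sub: "W \<subseteq> Y"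
    and eq: "block W i = block Y i" and s: "(s, i, j) \<in> Y"
  shows "(s, i, j) \<in> W"
proof -
  have "j \<in> block W i" using s eq by (auto simp: block_def)
  then obtain t where t: "(t, i, j) \<in> W" by (auto simp: block_def)
  show ?thesis
  proof (cases "0 \<in> block Y i")
    case True
    then show ?thesis using both_signs[OF W t] eq by simp
  next
    case False
    then show ?thesis using signs_unique[OF Y s] t sub by blast
  qed
qed

lemma signed_equiv_Inter:
  assumes "\<And>R. R \<in> A \<Longrightarrow> signed_equiv n R" "A \<noteq> {}"
  shows "signed_equiv n (\<Inter>A)"
proof -
  obtain R where R: "R \<in> A" using assms(2) by blast
  have "(\<forall>s i j. (s, i, j) \<in> \<Inter>A \<longrightarrow> i \<le> n \<and> j \<le> n)"
    using R signed_equiv_bound[OF assms(1)[OF R]] by blast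
  moreover have "(\<forall>i\<le>n. (True, i, i) \<in> \<Inter>A)"
    using signed_equiv_refl[OF assms(1)] by blast
  moreover have "(\<forall>s i j. (s, i, j) \<in> \<Inter>A \<longrightarrow> (s, j, i) \<in> \<Inter>A)"
    using signed_equiv_sym[OF assms(1)] by blast
  moreover have "(\<forall>s t i j l. (s, i, j) \<in> \<Inter>A \<longrightarrow> (t, j, l) \<in> \<Inter>A \<longrightarrow> (s = t, i, l) \<in> \<Inter>A)"
    using signed_equiv_trans[OF assms(1)] by blast
  moreover have "(False, 0, 0) \<in> \<Inter>A"
    using signed_equiv_zero[OF assms(1)] by blast
  moreover have "(\<forall>i. (False, i, i) \<in> \<Inter>A \<longrightarrow> (True, i, 0) \<in> \<Inter>A)"
    using signed_equiv_zeroD[OF assms(1)] by blast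
  ultimately show ?thesis unfolding signed_equiv_def by blast
qed

section \<open>Size constraints and rounding down\<close>

definition large :: "nat \<Rightarrow> nat \<Rightarrow> signed_rel \<Rightarrow> nat \<Rightarrow> bool" where
  "large k h R i \<longleftrightarrow> (if 0 \<in> block R i then h + 1 else k) \<le> card (block R i)"

definition equal_rels :: "nat \<Rightarrow> nat \<Rightarrow> nat \<Rightarrow> signed_rel set" where
  "equal_rels n k h = {R. signed_equiv n R \<and> (\<forall>i\<le>n. block R i = {i} \<or> large k h R i)}"

text \<open>In a block that is too small only loops survive. The loop \<open>(False, i, i)\<close>
  survives there for \<open>i = 0\<close> alone, because every other singleton is a signed
  block.\<close>

definition round_down :: "nat \<Rightarrow> nat \<Rightarrow> signed_rel \<Rightarrow> signed_rel" where
  "round_down k h R = {(s, i, j) \<in> R. large k h R i \<or> i = j \<and> (s \<or> i = 0)}"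

text \<open>A growing block that absorbs \<open>0\<close> trades the threshold \<open>k\<close> for
  \<open>h + 1\<close>; by \<open>h < k\<close> this does not raise it.\<close>

lemma large_mono:
  assumes "h < k" "signed_equiv n S" "R \<subseteq> S" "large k h R i"
  shows "large k h S i"
proof -
  have "card (block R i) \<le> card (block S i)"
    using assms block_mono finite_block by (metis card_mono)
  then show ?thesis using assms block_mono[OF assms(3), of i]
    by (auto simp: large_def split: if_splits)
qed

lemma large_cong: "block R i = block R j \<Longrightarrow> large k h R i = large k h R j"
  by (simp add: large_def)

lemma block_round_down:
  assumes R: "signed_equiv n R" and i: "i \<le> n"
  shows "block (round_down k h R) i = (if large k h R i then block R i else {i})"
  using signed_equiv_refl[OF R i] by (auto simp: block_def round_down_def)

lemma round_down_subset: "round_down k h R \<subseteq> R"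
  by (auto simp: round_down_def)

lemma round_down_in_equal_rels:
  assumes R: "signed_equiv n R"
  shows "round_down k h R \<in> equal_rels n k h"
proof -
  \<comment> \<open>Being large depends on the block only, so rounding down keeps or dissolves whole
    blocks.\<close>
  have cong: "large k h R i = large k h R j" if "(s, i, j) \<in> R" for s i j
    using block_eq[OF R, of j i] that large_cong[of R j i] by (auto simp: block_def)
  have "\<forall>s i j. (s, i, j) \<in> round_down k h R \<longrightarrow> i \<le> n \<and> j \<le> n"
    using signed_equiv_bound[OF R] by (auto simp: round_down_def)
  moreover have "\<forall>i\<le>n. (True, i, i) \<in> round_down k h R"
    using signed_equiv_refl[OF R] by (auto simp: round_down_def)
  moreover have "\<forall>s i j. (s, i, j) \<in> round_down k h R \<longrightarrow> (s, j, i) \<in> round_down k h R"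
    using signed_equiv_sym[OF R] cong by (auto simp: round_down_def)
  moreover have "(s = t, i, l) \<in> round_down k h R"
    if "(s, i, j) \<in> round_down k h R" "(t, j, l) \<in> round_down k h R" for s t i j l
    using that signed_equiv_trans[OF R, of s i j t l] cong[of s i j]
    by (auto simp: round_down_def)
  moreover have "(False, 0, 0) \<in> round_down k h R"
    using signed_equiv_zero[OF R] by (auto simp: round_down_def)
  moreover have "\<forall>i. (False, i, i) \<in> round_down k h R \<longrightarrow> (True, i, 0) \<in> round_down k h R"
    using signed_equiv_zeroD[OF R] by (auto simp: round_down_def)
  ultimately have "signed_equiv n (round_down k h R)" unfolding signed_equiv_def by blast
  moreover have "block (round_down k h R) i = {i} \<or> large k h (round_down k h R) i" if "i \<le> n" for i
    using block_round_down[OF R that, of k h] by (simp add: large_def split: if_splits)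
  ultimately show ?thesis by (simp add: equal_rels_def)
qed

text \<open>A nonsingleton block of \<open>T\<close> is large in \<open>T\<close>, hence lies in a
  large block of \<open>R\<close>, which rounding down leaves intact. This is what turns a rounded
  intersection into a meet.\<close>

lemma round_down_greatest:
  assumes "h < k" and T: "T \<in> equal_rels n k h" and R: "signed_equiv n R" and sub: "T \<subseteq> R"
  shows "T \<subseteq> round_down k h R"
proof
  fix x assume "x \<in> T"
  then obtain s i j where x: "x = (s, i, j)" "(s, i, j) \<in> T" by (cases x) auto
  have T': "signed_equiv n T" using T by (simp add: equal_rels_def)
  have "i \<le> n" using signed_equiv_bound[OF T'] x by blast
  with T consider "block T i = {i}" | "large k h T i" by (auto simp: equal_rels_def)
  then show "x \<in> round_down k h R"
  proof cases
    case 1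
    then have "j = i" using x by (auto simp: block_def)
    \<comment> \<open>A loop with sign \<open>False\<close> puts \<open>i\<close> into the zero
      block of \<open>T\<close>; if this block is \<open>{i}\<close>, then \<open>i\<close> is
      \<open>0\<close>.\<close>
    moreover have "s \<or> i = 0" using x 1 zero_block_iff[OF T', of i] \<open>j = i\<close> by (cases s) auto
    ultimately show ?thesis using x sub by (auto simp: round_down_def)
  next
    case 2
    then show ?thesis using large_mono[OF assms(1) R sub 2] x sub by (auto simp: round_down_def)
  qed
qed

section \<open>Splitting off a block\<close>

text \<open>Inside the block of \<open>c\<close> the signs are those of \<open>U\<close>:
  \<open>R\<close> may have merged this block into its zero block, where both signs occur.\<close>

definition split_off :: "signed_rel \<Rightarrow> nat \<Rightarrow> signed_rel \<Rightarrow> signed_rel" where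
  "split_off U c R = {(s, i, j) \<in> R.
     i \<in> block U c \<and> j \<in> block U c \<and> (s, i, j) \<in> U \<or> i \<notin> block U c \<and> j \<notin> block U c}"

lemma split_off_subset: "split_off U c R \<subseteq> R"
  by (auto simp: split_off_def)

lemma split_off_mono: "R \<subseteq> S \<Longrightarrow> split_off U c R \<subseteq> split_off U c S"
  by (auto simp: split_off_def)

context
  fixes n :: nat and U R :: signed_rel and c :: nat
  assumes U: "signed_equiv n U" and R: "signed_equiv n R" and UR: "U \<subseteq> R"
    and c: "0 \<notin> block U c"
begin

lemma split_off_above: "U \<subseteq> split_off U c R"
proof -
  have "i \<in> block U c \<longleftrightarrow> j \<in> block U c" if "(s, i, j) \<in> U" for s i j
    using that signed_equiv_sym[OF U] signed_equiv_trans[OF U] unfolding block_def by blast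
  then show ?thesis using UR by (auto simp: split_off_def)
qed

lemma signed_equiv_split_off: "signed_equiv n (split_off U c R)"
proof -
  have "\<forall>s i j. (s, i, j) \<in> split_off U c R \<longrightarrow> i \<le> n \<and> j \<le> n"
    using signed_equiv_bound[OF R] by (auto simp: split_off_def)
  moreover have "\<forall>i\<le>n. (True, i, i) \<in> split_off U c R"
    using signed_equiv_refl[OF R] signed_equiv_refl[OF U] by (auto simp: split_off_def)
  moreover have "\<forall>s i j. (s, i, j) \<in> split_off U c R \<longrightarrow> (s, j, i) \<in> split_off U c R"
    using signed_equiv_sym[OF R] signed_equiv_sym[OF U] by (auto simp: split_off_def)
  moreover have "\<forall>s t i j l. (s, i, j) \<in> split_off U c R \<longrightarrow> (t, j, l) \<in> split_off U c R
      \<longrightarrow> (s = t, i, l) \<in> split_off U c R"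
    unfolding split_off_def
    using signed_equiv_trans[OF R] signed_equiv_trans[OF U] by blast
  moreover have "(False, 0, 0) \<in> split_off U c R"
    using signed_equiv_zero[OF R] c by (auto simp: split_off_def)
  moreover have "(True, i, 0) \<in> split_off U c R" if "(False, i, i) \<in> split_off U c R" for i
  proof -
    have "i \<notin> block U c"
      using that zero_block_iff[OF U, of i] block_eq[OF U, of i c] c by (auto simp: split_off_def)
    then show ?thesis using that signed_equiv_zeroD[OF R, of i] c by (auto simp: split_off_def)
  qed
  ultimately show ?thesis unfolding signed_equiv_def by blast
qed

lemma block_split_off: "i \<notin> block U c \<Longrightarrow> block (split_off U c R) i = block R i - block U c"
  by (auto simp: split_off_def block_def)

text \<open>If the block of \<open>c\<close> is the same in \<open>Y\<close> and \<open>U\<close>,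
  then \<open>Y\<close> has the signs of \<open>U\<close> there and no pair of \<open>Y\<close>
  leaves it. Conversely, \<open>split_off\<close> relates \<open>c\<close> to elements of
  \<open>block U c\<close> only.\<close>

lemma below_split_off_iff:
  assumes Y: "signed_equiv n Y" and UY: "U \<subseteq> Y" and YR: "Y \<subseteq> R"
  shows "Y \<subseteq> split_off U c R \<longleftrightarrow> block Y c = block U c"
proof
  assume sub: "Y \<subseteq> split_off U c R"
  have "j \<in> block U c" if "j \<in> block Y c" for j
  proof -
    from that obtain s where s: "(s, c, j) \<in> Y" by (auto simp: block_def)
    then have "c \<in> block U c" using signed_equiv_bound[OF Y] block_self[OF U] by blast
    then show ?thesis using s sub by (auto simp: split_off_def)
  qed
  then show "block Y c = block U c" using block_mono[OF UY, of c] by blast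
next
  assume eq: "block Y c = block U c"
  show "Y \<subseteq> split_off U c R"
  proof
    fix x assume "x \<in> Y"
    then obtain s i j where x: "x = (s, i, j)" "(s, i, j) \<in> Y" by (cases x) auto
    have ij: "block Y i = block Y j" using x block_eq[OF Y, of j i] by (auto simp: block_def)
    have le: "i \<le> n" "j \<le> n" using x signed_equiv_bound[OF Y] by blast+
    show "x \<in> split_off U c R"
    proof (cases "i \<in> block U c")
      case True
      then have "block Y i = block U i"
        using eq block_eq[OF Y, of i c] block_eq[OF U, of i c] by simp
      then have "(s, i, j) \<in> U" using signed_equiv_block_eqD[OF U Y UY _ x(2)] by simp
      moreover have "j \<in> block U c"
        using ij block_self[OF Y le(2)] eq block_eq[OF Y, of i c] True by simp
      ultimately show ?thesis using True x YR by (auto simp: split_off_def)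
    next
      case False
      have "j \<notin> block U c"
        using False ij block_self[OF Y le(1)] eq block_eq[OF Y, of j c] by metis
      then show ?thesis using False x YR by (auto simp: split_off_def)
    qed
  qed
qed

end

text \<open>
  If the rest $E \setminus C$ of the block $E$ of $c$ in \<open>Y\<close> is still large, then \<open>W\<close> contains it as
  a whole. Otherwise $C$ is a singleton and $E$ has the minimal size allowed, so no nonsingleton
  block of \<open>W\<close> fits strictly inside $E$; or $C$ is not a singleton and $E \setminus C = \{0\}$.
\<close>

lemma above_split_off_eq:
  assumes hk: "h < k" and U: "U \<in> equal_rels n k h" and Y: "Y \<in> equal_rels n k h"
    and W: "W \<in> equal_rels n k h" and UY: "U \<subseteq> Y"
    and c: "c \<le> n" "0 \<notin> block U c"
    and single: "block U c = {c} \<or> (\<forall>i \<in> block Y c. i = 0 \<or> block U i \<noteq> {i})"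
    and SW: "round_down k h (split_off U c Y) \<subseteq> W" and WY: "W \<subseteq> Y"
    and ne: "block W c \<noteq> block U c"
  shows "W = Y"
proof -
  let ?S = "split_off U c Y"
  have U': "signed_equiv n U" and Y': "signed_equiv n Y" and W': "signed_equiv n W"
    using U Y W by (auto simp: equal_rels_def)
  note S' = signed_equiv_split_off[OF U' Y' UY c(2)]
  have US: "U \<subseteq> ?S" by (rule split_off_above[OF U' Y' UY c(2)])
  have "U \<subseteq> round_down k h ?S" by (rule round_down_greatest[OF hk U S' US])
  then have UW: "U \<subseteq> W" using SW by blast
  \<comment> \<open>In \<open>W\<close> the block of \<open>c\<close> has grown, as \<open>d\<close>
    witnesses. By \<open>Sd\<close>, the block of \<open>d\<close> in \<open>?S\<close> is all of
    \<open>block Y c - block U c\<close>.\<close>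
  from ne block_mono[OF UW, of c] obtain d where d: "d \<in> block W c" "d \<notin> block U c" by blast
  have dY: "d \<in> block Y c" using d(1) block_mono[OF WY] by blast
  have Sd: "block ?S e = block Y c - block U c" if "e \<in> block Y c - block U c" for e
    using block_split_off[OF U' Y' UY c(2), of e] block_eq[OF Y', of e c] that by simp
  have Wc: "block W c \<subseteq> block Y c" by (rule block_mono[OF WY])
  \<comment> \<open>A large block of \<open>Y\<close> other than that of \<open>c\<close> is
    disjoint from \<open>block U c\<close>, so it survives both the splitting and the
    rounding.\<close>
  have in_W: "(s, i, j) \<in> W" if "large k h Y i" "i \<notin> block Y c" "(s, i, j) \<in> Y" for s i j
  proof -
    have disj: "block Y i \<inter> block U c = {}"
      using that(2) block_mono[OF UY, of c] block_eq[OF Y', of _ i] block_eq[OF Y', of _ c]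
        block_self[OF Y' signed_equiv_bound(1)[OF Y' that(3)]] by blast
    have i: "i \<in> block Y i" "j \<in> block Y i"
      using that(3) block_self[OF Y'] signed_equiv_bound[OF Y'] by (auto simp: block_def)
    then have "block ?S i = block Y i"
      using block_split_off[OF U' Y' UY c(2), of i] disj by blast
    then have "large k h ?S i" using that(1) by (simp add: large_def)
    moreover have "(s, i, j) \<in> ?S" using that(3) i disj by (auto simp: split_off_def)
    ultimately show ?thesis using SW by (auto simp: round_down_def)
  qed
  have full: "block W c = block Y c"
  proof (cases "large k h ?S d")
    case True
    have "e \<in> block W c" if e: "e \<in> block Y c" "e \<notin> block U c" for e
    proof -
      have "e \<in> block ?S d" using Sd[of d] d dY e by simp
      then have "e \<in> block W d" using True SW by (auto simp: block_def round_down_def)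
      then show ?thesis using block_eq[OF W' d(1)] by simp
    qed
    then show ?thesis using block_mono[OF UW, of c] Wc by blast
  next
    case False
    show ?thesis
    proof (cases "block U c = {c}")
      case True
      have "d \<noteq> c" using d True by auto
      then have "block W c \<noteq> {c}" using d by blast
      then have lW: "large k h W c" using W c(1) by (auto simp: equal_rels_def)
      have "card (block ?S d) = card (block Y c) - 1"
        using Sd[of d] d dY True block_self[OF Y' c(1)] by simp
      moreover have "0 \<in> block ?S d \<longleftrightarrow> 0 \<in> block Y c"
        using Sd[of d] d dY c(2) by simp
      \<comment> \<open>Without \<open>c\<close> the block of \<open>Y\<close> is too small, so its
        size is at most its threshold. The threshold for \<open>block W c\<close> is no lower: if
        \<open>0\<close> lies in \<open>block Y c\<close> but not in \<open>block W c\<close>, it is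
        \<open>k\<close> instead of \<open>h + 1\<close>.\<close>
      ultimately have "card (block Y c) \<le> card (block W c)"
        using False lW hk Wc by (auto simp: large_def split: if_splits)
      then show ?thesis using card_seteq[OF finite_block[OF Y'] Wc] by simp
    next
      case nsing: False
      \<comment> \<open>A nonsingleton block of \<open>U\<close> is large and would make the rest,
        which is one block of \<open>?S\<close>, large as well.\<close>
      have *: "block U e = {e}" if e: "e \<in> block Y c - block U c" for e
      proof (rule ccontr)
        assume "block U e \<noteq> {e}"
        moreover have "e \<le> n" using e block_subset[OF Y', of c] by auto
        ultimately have "large k h U e" using U by (auto simp: equal_rels_def)
        then have "large k h ?S e" by (rule large_mono[OF hk S' US])
        then show False using False Sd[OF e] Sd[of d] d dY large_cong[of ?S e d] by simp
      qed
      \<comment> \<open>By the second alternative of \<open>single\<close> only \<open>0\<close> can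
        remain. So \<open>d\<close> is \<open>0\<close>, and \<open>block W c\<close> already
        exhausts \<open>block Y c\<close>.\<close>
      have "block Y c - block U c \<subseteq> {0}" using * single nsing by blast
      then show ?thesis using d dY block_mono[OF UW, of c] Wc by blast
    qed
  qed
  have "(s, i, j) \<in> W" if s: "(s, i, j) \<in> Y" for s i j
  proof (cases "i \<in> block Y c")
    case True
    then have "block W i = block Y i"
      using full block_eq[OF Y' True] block_eq[OF W', of i c] by simp
    then show ?thesis by (rule signed_equiv_block_eqD[OF W' Y' WY _ s])
  next
    case False
    have "i \<le> n" using s signed_equiv_bound[OF Y'] by blast
    then consider "block Y i = {i}" | "large k h Y i" using Y by (auto simp: equal_rels_def)
    then show ?thesis
    proof cases
      case 1
      then have "block W i = block Y i"
        using block_mono[OF WY, of i] block_self[OF W' \<open>i \<le> n\<close>] by auto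
      then show ?thesis by (rule signed_equiv_block_eqD[OF W' Y' WY _ s])
    next
      case 2
      then show ?thesis using in_W False s by blast
    qed
  qed
  then show ?thesis using WY by auto
qed

section \<open>The choice of the block and the left-modular coatom\<close>

text \<open>If every signed block of \<open>U\<close> were a block of \<open>V\<close>, the two
  relations would agree, since pairs in the zero block of \<open>U\<close> already have both signs.
  The last condition on \<open>c\<close> comes from preferring singletons.\<close>

lemma unmerged_block_exists:
  assumes U: "signed_equiv n U" and V: "signed_equiv n V" and UV: "U \<subset> V"
  obtains c where "c \<le> n" "0 \<notin> block U c" "block U c \<noteq> block V c"
    "block U c = {c} \<or> (\<forall>i \<in> block V c. i = 0 \<or> block U i \<noteq> {i})"
proof -
  define P where "P c \<longleftrightarrow> c \<le> n \<and> 0 \<notin> block U c \<and> block U c \<noteq> block V c" for c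
  have "\<exists>c. P c"
  proof (rule ccontr)
    assume "\<nexists>c. P c"
    then have P: "block U i = block V i" if "i \<le> n" "0 \<notin> block U i" for i
      using that by (auto simp: P_def)
    have "(s, i, j) \<in> U" if s: "(s, i, j) \<in> V" for s i j
    proof -
      have le: "i \<le> n" "j \<le> n" using s signed_equiv_bound[OF V] by blast+
      consider "0 \<notin> block U i" | "0 \<notin> block U j" | "0 \<in> block U i" "0 \<in> block U j" by blast
      then show ?thesis
      proof cases
        case 1
        then show ?thesis using signed_equiv_block_eqD[OF U V _ _ s] P le UV by blast
      next
        case 2
        then have "(s, j, i) \<in> U"
          using signed_equiv_block_eqD[OF U V _ _ signed_equiv_sym[OF V s]] P le UV by blast
        then show ?thesis by (rule signed_equiv_sym[OF U])
      next
        case 3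
        then have "j \<in> block U i"
          using block_sym[OF U 3(2)] block_eq[OF U 3(1)] by simp
        then show ?thesis using both_signs[OF U _ 3(1)] by (auto simp: block_def)
      qed
    qed
    then show False using UV by auto
  qed
  then obtain c0 where c0: "P c0" by blast
  show ?thesis
  proof (cases "\<exists>c. P c \<and> block U c = {c}")
    case True
    then show ?thesis using that by (auto simp: P_def)
  next
    case False
    \<comment> \<open>As no singleton qualifies, a nonzero singleton of \<open>U\<close> is still a
      block of \<open>V\<close>, so it cannot lie in \<open>block V c0\<close>.\<close>
    have "block U c0 = {c0} \<or> (\<forall>i \<in> block V c0. i = 0 \<or> block U i \<noteq> {i})"
    proof (rule disjI2, rule ballI, rule ccontr)
      fix i assume i: "i \<in> block V c0" and "\<not> (i = 0 \<or> block U i \<noteq> {i})"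
      then have s: "i \<noteq> 0" "block U i = {i}" by auto
      have "\<not> P i" using False s by blast
      moreover have "i \<le> n" using i block_subset[OF V, of c0] by auto
      ultimately have "block V i = {i}" using s by (auto simp: P_def)
      then have "i = c0" using block_sym[OF V i] by auto
      then show False using False c0 s by blast
    qed
    then show ?thesis using that c0 by (auto simp: P_def)
  qed
qed

lemma equal_rels_modular_coatom:
  assumes hk: "h < k" and U: "U \<in> equal_rels n k h" and V: "V \<in> equal_rels n k h"
    and UV: "U \<subset> V"
  shows "\<exists>M \<in> equal_rels n k h. U \<subseteq> M \<and> M \<subset> V \<and>
    (\<forall>Y \<in> equal_rels n k h. U \<subseteq> Y \<longrightarrow> Y \<subseteq> V \<longrightarrow> \<not> Y \<subseteq> M \<longrightarrow>
      (\<exists>S \<in> equal_rels n k h. U \<subseteq> S \<and> S \<subseteq> M \<and> S \<subseteq> Y \<and>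
        (\<forall>W \<in> equal_rels n k h. S \<subseteq> W \<longrightarrow> W \<subseteq> Y \<longrightarrow> \<not> W \<subseteq> M \<longrightarrow> W = Y)))"
proof -
  have sgn: "signed_equiv n R" if "R \<in> equal_rels n k h" for R
    using that by (simp add: equal_rels_def)
  obtain c where c: "c \<le> n" "0 \<notin> block U c" "block U c \<noteq> block V c"
    and single: "block U c = {c} \<or> (\<forall>i \<in> block V c. i = 0 \<or> block U i \<noteq> {i})"
    by (rule unmerged_block_exists[OF sgn[OF U] sgn[OF V] UV])
  \<comment> \<open>\<open>?m V\<close> is the coatom, and \<open>?m Y\<close> is the element
    \<open>S\<close> belonging to \<open>Y\<close>.\<close>
  let ?m = "\<lambda>Y. round_down k h (split_off U c Y)"
  have UV': "U \<subseteq> V" using UV by blast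
  have m: "?m Y \<in> equal_rels n k h" "U \<subseteq> ?m Y" "?m Y \<subseteq> Y"
    if Y: "Y \<in> equal_rels n k h" "U \<subseteq> Y" for Y
  proof -
    note S = signed_equiv_split_off[OF sgn[OF U] sgn[OF Y(1)] Y(2) c(2)]
    show "?m Y \<in> equal_rels n k h" by (rule round_down_in_equal_rels[OF S])
    show "U \<subseteq> ?m Y"
      by (rule round_down_greatest[OF hk U S
            split_off_above[OF sgn[OF U] sgn[OF Y(1)] Y(2) c(2)]])
    show "?m Y \<subseteq> Y" using round_down_subset split_off_subset by blast
  qed
  have le_m: "Y \<subseteq> ?m V \<longleftrightarrow> block Y c = block U c"
    if Y: "Y \<in> equal_rels n k h" "U \<subseteq> Y" "Y \<subseteq> V" for Y
  proof -
    have "Y \<subseteq> ?m V \<longleftrightarrow> Y \<subseteq> split_off U c V"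
      using round_down_subset[of k h "split_off U c V"]
        round_down_greatest[OF hk Y(1) signed_equiv_split_off[OF sgn[OF U] sgn[OF V] UV' c(2)]]
      by blast
    then show ?thesis
      using below_split_off_iff[OF sgn[OF U] sgn[OF V] UV' c(2) sgn[OF Y(1)] Y(2,3)] by simp
  qed
  have "\<not> V \<subseteq> ?m V" using le_m[OF V UV'] c(3) by auto
  then have mV: "?m V \<subset> V" using m(3)[OF V UV'] by blast
  have "\<exists>S \<in> equal_rels n k h. U \<subseteq> S \<and> S \<subseteq> ?m V \<and> S \<subseteq> Y \<and>
        (\<forall>W \<in> equal_rels n k h. S \<subseteq> W \<longrightarrow> W \<subseteq> Y \<longrightarrow> \<not> W \<subseteq> ?m V \<longrightarrow> W = Y)"
    if Y: "Y \<in> equal_rels n k h" "U \<subseteq> Y" "Y \<subseteq> V" for Y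
  proof (intro bexI[of _ "?m Y"] conjI ballI impI)
    show "?m Y \<in> equal_rels n k h" "U \<subseteq> ?m Y" "?m Y \<subseteq> Y" using m[OF Y(1,2)] by auto
    have "?m Y \<subseteq> split_off U c V"
      using round_down_subset[of k h "split_off U c Y"] split_off_mono[OF Y(3), of U c] by blast
    then show "?m Y \<subseteq> ?m V"
      by (rule round_down_greatest[OF hk m(1)[OF Y(1,2)]
            signed_equiv_split_off[OF sgn[OF U] sgn[OF V] UV' c(2)]])
    fix W assume W: "W \<in> equal_rels n k h" "?m Y \<subseteq> W" "W \<subseteq> Y" "\<not> W \<subseteq> ?m V"
    have "U \<subseteq> W" "W \<subseteq> V" using W Y m(2)[OF Y(1,2)] by blast+
    then have "block W c \<noteq> block U c" using le_m[OF W(1)] W(4) by blast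
    then show "W = Y"
      using above_split_off_eq[OF hk U Y(1) W(1) Y(2) c(1,2) _ W(2,3)] single block_mono[OF Y(3), of c]
      by blast
  qed
  then show ?thesis using m[OF V UV'] mV by (intro bexI[of _ "?m V"]) auto
qed

section \<open>Meets and top of the family of relations\<close>

lemma equal_rels_Inf:
  assumes "h < k" "A \<subseteq> equal_rels n k h" "A \<noteq> {}"
  shows "\<exists>M \<in> equal_rels n k h. M \<subseteq> \<Inter>A \<and> (\<forall>S \<in> equal_rels n k h. S \<subseteq> \<Inter>A \<longrightarrow> S \<subseteq> M)"
proof -
  have "signed_equiv n (\<Inter>A)"
    using assms by (intro signed_equiv_Inter) (auto simp: equal_rels_def)
  then show ?thesis
    using round_down_greatest[OF assms(1)]
    by (intro bexI[of _ "round_down k h (\<Inter>A)"] conjI ballI impI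
        round_down_subset round_down_in_equal_rels) auto
qed

text \<open>Everything lies in one zero block, whose size \<open>n + 1\<close> is at least
  \<open>h + 1\<close>.\<close>

lemma equal_rels_top:
  assumes "h < k" "k \<le> n"
  shows "UNIV \<times> {0..n} \<times> {0..n} \<in> equal_rels n k h"
proof -
  have "block (UNIV \<times> {0..n} \<times> {0..n}) i = {0..n}" if "i \<le> n" for i
    using that by (auto simp: block_def)
  then have "large k h (UNIV \<times> {0..n} \<times> {0..n}) i" if "i \<le> n" for i
    using that assms by (simp add: large_def)
  then show ?thesis by (auto simp: equal_rels_def signed_equiv_def)
qed

section \<open>Signed partitions as signed equivalence relations\<close>

text \<open>Reversal is an involution, so either member can represent the pattern.\<close>

lemma sign_patterns_memD:
  assumes p: "p \<in> sign_patterns B" and f: "f \<in> p"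
  shows "f \<in> B \<rightarrow>\<^sub>E UNIV" "p = {f, restrict (\<lambda>i. \<not> f i) B}"
proof -
  from p obtain g where g: "g \<in> B \<rightarrow>\<^sub>E UNIV" "p = {g, restrict (\<lambda>i. \<not> g i) B}"
    by (auto simp: sign_patterns_def)
  then have inv: "restrict (\<lambda>i. \<not> restrict (\<lambda>i. \<not> g i) B i) B = g"
    by (auto simp: fun_eq_iff PiE_def extensional_def)
  have "f = g \<or> f = restrict (\<lambda>i. \<not> g i) B" using f g by auto
  then show "f \<in> B \<rightarrow>\<^sub>E UNIV" "p = {f, restrict (\<lambda>i. \<not> f i) B}"
    using g inv by auto
qed

lemma sign_patterns_nonempty: "p \<in> sign_patterns B \<Longrightarrow> p \<noteq> {}"
  by (auto simp: sign_patterns_def)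

lemma sign_patterns_agree:
  assumes "p \<in> sign_patterns B" "f \<in> p" "g \<in> p" "i \<in> B" "j \<in> B"
  shows "(f i = f j) \<longleftrightarrow> (g i = g j)"
  using sign_patterns_memD(2)[OF assms(1,2)] assms(3-5) by auto

text \<open>If the representatives differ at one element \<open>b\<close>, comparison with
  \<open>b\<close> shows that they differ everywhere and are reversals of each other. So relative
  signs determine a pattern.\<close>

lemma sign_patterns_eqI:
  assumes p: "p \<in> sign_patterns B" "f \<in> p" and q: "q \<in> sign_patterns B" "g \<in> q"
    and eq: "\<And>i j. \<lbrakk>i \<in> B; j \<in> B\<rbrakk> \<Longrightarrow> (f i = f j) \<longleftrightarrow> (g i = g j)"
  shows "p = q"
proof -
  have f: "f \<in> B \<rightarrow>\<^sub>E UNIV" and g: "g \<in> B \<rightarrow>\<^sub>E UNIV"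
    using sign_patterns_memD(1) p q by blast+
  have "f = g \<or> f = restrict (\<lambda>i. \<not> g i) B"
  proof (cases "\<forall>i \<in> B. f i = g i")
    case True
    then have "f = g" using f g by (intro PiE_ext) auto
    then show ?thesis by simp
  next
    case False
    then obtain b where b: "b \<in> B" "f b \<noteq> g b" by blast
    have "f i = (\<not> g i)" if "i \<in> B" for i using eq[OF b(1) that] b(2) by auto
    then have "f = restrict (\<lambda>i. \<not> g i) B" using f by (auto simp: fun_eq_iff PiE_def extensional_def)
    then show ?thesis by simp
  qed
  then have "f \<in> q" using sign_patterns_memD(2)[OF q] by auto
  then show ?thesis using sign_patterns_memD(2)[OF q(1), of f] sign_patterns_memD(2)[OF p] by simp
qed

lemma restrict_pattern_in_sign_patterns:
  assumes p: "p \<in> sign_patterns C" and "A \<subseteq> C"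
  shows "restrict_pattern p A \<in> sign_patterns A"
proof -
  obtain f where f: "f \<in> p" using sign_patterns_nonempty[OF p] by blast
  have "restrict_pattern p A = {restrict f A, restrict (\<lambda>i. \<not> restrict f A i) A}"
    unfolding restrict_pattern_def sign_patterns_memD(2)[OF p f]
    using \<open>A \<subseteq> C\<close> by (auto simp: fun_eq_iff)
  moreover have "restrict f A \<in> A \<rightarrow>\<^sub>E UNIV" by auto
  ultimately show ?thesis unfolding sign_patterns_def by blast
qed

section \<open>The relation of a signed partition\<close>

text \<open>The sign \<open>True\<close> records equal signs. Reversal preserves relative signs, so
  every \<open>f\<close> in the pattern yields the same triples.\<close>

definition rel_of :: "signed_partition \<Rightarrow> signed_rel" where
  "rel_of x = {(s, i, j). \<exists>B \<in> fst x. i \<in> B \<and> j \<in> B \<and> (0 \<in> B \<or> (\<exists>f \<in> snd x B. (f i = f j) = s))}"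

lemma partition_on_same_block:
  "\<lbrakk>partition_on S P; A \<in> P; B \<in> P; i \<in> A; i \<in> B\<rbrakk> \<Longrightarrow> A = B"
  by (auto simp: partition_on_def disjoint_def)

context
  fixes n :: nat and P :: "nat set set" and \<sigma> :: "nat set \<Rightarrow> (nat \<Rightarrow> bool) set"
  assumes x: "(P, \<sigma>) \<in> signed_partitions n"
begin

lemma signed_partition_partition_on: "partition_on {0..n} P"
  using x by (auto simp: signed_partitions_def)

lemma signed_partition_pattern: "B \<in> P \<Longrightarrow> 0 \<notin> B \<Longrightarrow> \<sigma> B \<in> sign_patterns B"
  using x by (auto simp: signed_partitions_def signed_blocks_def)

lemma signed_partition_block: "i \<le> n \<Longrightarrow> \<exists>B \<in> P. i \<in> B"
  using partition_onD1[OF signed_partition_partition_on] by auto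

lemma signed_partition_same: "\<lbrakk>A \<in> P; B \<in> P; i \<in> A; i \<in> B\<rbrakk> \<Longrightarrow> A = B"
  using partition_on_same_block[OF signed_partition_partition_on] by blast

lemma signed_partition_bound: "\<lbrakk>B \<in> P; i \<in> B\<rbrakk> \<Longrightarrow> i \<le> n"
  using partition_onD1[OF signed_partition_partition_on] by auto

lemma rel_of_iff:
  assumes "B \<in> P" "i \<in> B"
  shows "(s, i, j) \<in> rel_of (P, \<sigma>) \<longleftrightarrow> j \<in> B \<and> (0 \<in> B \<or> (\<exists>f \<in> \<sigma> B. (f i = f j) = s))"
proof -
  have "A = B" if "A \<in> P" "i \<in> A" for A using signed_partition_same that assms by blast
  then have "(\<exists>A \<in> P. i \<in> A \<and> Q A) \<longleftrightarrow> Q B" for Q using assms by blast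
  then show ?thesis by (simp add: rel_of_def)
qed

lemma rel_of_signed_iff:
  assumes "B \<in> P" "i \<in> B" "0 \<notin> B" "f \<in> \<sigma> B"
  shows "(s, i, j) \<in> rel_of (P, \<sigma>) \<longleftrightarrow> j \<in> B \<and> (f i = f j) = s"
proof -
  have "(\<exists>g \<in> \<sigma> B. (g i = g j) = s) \<longleftrightarrow> (f i = f j) = s" if "j \<in> B"
    using sign_patterns_agree[OF signed_partition_pattern[OF assms(1,3)] assms(4) _ assms(2) that]
      assms(4) by blast
  then show ?thesis using rel_of_iff[OF assms(1,2), of s j] assms(3) by blast
qed

lemma block_rel_of:
  assumes "B \<in> P" "i \<in> B"
  shows "block (rel_of (P, \<sigma>)) i = B"
proof -
  have "\<exists>f. f \<in> \<sigma> B" if "0 \<notin> B"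
    using sign_patterns_nonempty[OF signed_partition_pattern[OF assms(1) that]] by blast
  then show ?thesis using rel_of_iff[OF assms] by (auto simp: block_def)
qed

lemma signed_equiv_rel_of: "signed_equiv n (rel_of (P, \<sigma>))"
proof -
  let ?R = "rel_of (P, \<sigma>)"
  have dest: "\<exists>B \<in> P. i \<in> B \<and> j \<in> B" if "(s, i, j) \<in> ?R" for s i j
    using that by (auto simp: rel_of_def)
  have pat: "\<exists>f. f \<in> \<sigma> B" if "B \<in> P" "0 \<notin> B" for B
    using sign_patterns_nonempty[OF signed_partition_pattern[OF that]] by blast
  have "\<forall>s i j. (s, i, j) \<in> ?R \<longrightarrow> i \<le> n \<and> j \<le> n"
    using dest signed_partition_bound by blast
  moreover have "(True, i, i) \<in> ?R" if "i \<le> n" for i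
  proof -
    obtain B where B: "B \<in> P" "i \<in> B" using signed_partition_block[OF \<open>i \<le> n\<close>] by blast
    then show ?thesis using rel_of_iff[OF B, of True i] pat[OF B(1)] by auto
  qed
  moreover have "(s, j, i) \<in> ?R" if sij: "(s, i, j) \<in> ?R" for s i j
  proof -
    obtain B where B: "B \<in> P" "i \<in> B" "j \<in> B" using dest[OF sij] by blast
    have "(f j = f i) = (f i = f j)" for f :: "nat \<Rightarrow> bool" by auto
    then show ?thesis using sij rel_of_iff[OF B(1,2), of s j] rel_of_iff[OF B(1,3), of s i] B by simp
  qed
  moreover have "(s = t, i, l) \<in> ?R" if st: "(s, i, j) \<in> ?R" "(t, j, l) \<in> ?R" for s t i j l
  proof -
    obtain B where B: "B \<in> P" "i \<in> B" "j \<in> B" using dest[OF st(1)] by blast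
    show ?thesis
    proof (cases "0 \<in> B")
      case True
      then show ?thesis using st B by (simp add: rel_of_iff[of B])
    next
      case False
      then obtain f where f: "f \<in> \<sigma> B" using pat[OF B(1)] by blast
      have "(f i = f j) = s" "l \<in> B" "(f j = f l) = t"
        using st B False f by (simp_all add: rel_of_signed_iff[of B _ f])
      then show ?thesis using B False f by (auto simp add: rel_of_signed_iff[of B _ f])
    qed
  qed
  moreover have "(False, 0, 0) \<in> ?R"
    using signed_partition_block[of 0] by (auto simp: rel_of_def)
  moreover have "(True, i, 0) \<in> ?R" if "(False, i, i) \<in> ?R" for i
    using that by (auto simp: rel_of_def)
  ultimately show ?thesis unfolding signed_equiv_def by blast
qed

text \<open>Recovers the underlying partition from the relation, for the injectivity of
  \<open>rel_of\<close>.\<close>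

lemma blocks_eq_rel_of: "P = (\<lambda>i. block (rel_of (P, \<sigma>)) i) ` {0..n}"
proof (intro equalityI subsetI)
  fix B assume B: "B \<in> P"
  then obtain i where "i \<in> B" using partition_onD3[OF signed_partition_partition_on] by fastforce
  then show "B \<in> (\<lambda>i. block (rel_of (P, \<sigma>)) i) ` {0..n}"
    using block_rel_of[OF B] signed_partition_bound[OF B] by force
next
  fix B assume "B \<in> (\<lambda>i. block (rel_of (P, \<sigma>)) i) ` {0..n}"
  then obtain i where i: "i \<le> n" "B = block (rel_of (P, \<sigma>)) i" by auto
  then show "B \<in> P" using signed_partition_block[OF i(1)] block_rel_of by auto
qed

end

text \<open>Each pair in a signed block has exactly one relative sign, so inclusion leaves no
  freedom once the blocks agree. Besides injectivity, this settles the end of a chain of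
  covers.\<close>

lemma rel_of_subset_same_blocks:
  assumes x: "(P, \<sigma>) \<in> signed_partitions n" and y: "(P, \<tau>) \<in> signed_partitions n"
    and sub: "rel_of (P, \<sigma>) \<subseteq> rel_of (P, \<tau>)"
  shows "\<sigma> = \<tau>"
proof (rule PiE_ext)
  show "\<sigma> \<in> (\<Pi>\<^sub>E B \<in> signed_blocks P. sign_patterns B)"
    "\<tau> \<in> (\<Pi>\<^sub>E B \<in> signed_blocks P. sign_patterns B)"
    using x y by (auto simp: signed_partitions_def)
  fix B assume "B \<in> signed_blocks P"
  then have B: "B \<in> P" "0 \<notin> B" by (auto simp: signed_blocks_def)
  note px = signed_partition_pattern[OF x B] and py = signed_partition_pattern[OF y B]
  obtain f g where f: "f \<in> \<sigma> B" and g: "g \<in> \<tau> B"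
    using sign_patterns_nonempty px py by blast
  show "\<sigma> B = \<tau> B"
  proof (rule sign_patterns_eqI[OF px f py g])
    fix i j assume ij: "i \<in> B" "j \<in> B"
    then have "(f i = f j, i, j) \<in> rel_of (P, \<tau>)"
      using sub rel_of_signed_iff[OF x B(1) ij(1) B(2) f] by auto
    then show "(f i = f j) = (g i = g j)"
      using rel_of_signed_iff[OF y B(1) ij(1) B(2) g] by auto
  qed
qed

lemma inj_on_rel_of: "inj_on rel_of (signed_partitions n)"
proof (rule inj_onI)
  fix x y assume *: "x \<in> signed_partitions n" "y \<in> signed_partitions n" "rel_of x = rel_of y"
  obtain P \<sigma> Q \<tau> where xy: "x = (P, \<sigma>)" "y = (Q, \<tau>)" by (cases x, cases y)
  have "P = Q" using blocks_eq_rel_of[of P \<sigma> n] blocks_eq_rel_of[of Q \<tau> n] * xy by simp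
  then show "x = y" using rel_of_subset_same_blocks[of P \<sigma> n \<tau>] * xy by simp
qed

lemma rel_of_surj:
  assumes R: "signed_equiv n R"
  shows "\<exists>x \<in> signed_partitions n. rel_of x = R"
proof -
  define P where "P = block R ` {0..n}"
  \<comment> \<open>A base point is chosen in \<open>B\<close>, and \<open>i\<close> is positive if
    it is positively related to the base point. In a signed block the relating sign is unique, so
    the relative signs of \<open>g B\<close> are those of \<open>R\<close>.\<close>
  define g where "g B = restrict (\<lambda>i. (True, SOME b. b \<in> B, i) \<in> R) B" for B
  define \<sigma> where "\<sigma> = restrict (\<lambda>B. {g B, restrict (\<lambda>i. \<not> g B i) B}) (signed_blocks P)"
  have blockP: "block R i \<in> P" if "i \<le> n" for i using that by (auto simp: P_def)
  have P_block: "B = block R i" if "B \<in> P" "i \<in> B" for B i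
    using that block_eq[OF R] by (auto simp: P_def)
  have "partition_on {0..n} P"
  proof (rule partition_onI)
    show "\<Union>P = {0..n}"
      using block_subset[OF R] block_self[OF R] by (fastforce simp: P_def)
    show "disjnt A B" if "A \<in> P" "B \<in> P" "A \<noteq> B" for A B
      using that P_block by (auto simp: disjnt_def)
    show "{} \<notin> P" using block_self[OF R] by (fastforce simp: P_def)
  qed
  moreover have "\<sigma> \<in> (\<Pi>\<^sub>E B \<in> signed_blocks P. sign_patterns B)"
  proof (unfold \<sigma>_def, rule iffD2[OF restrict_PiE_iff], rule ballI)
    fix B
    have "g B \<in> B \<rightarrow>\<^sub>E UNIV" by (simp add: g_def)
    then show "{g B, restrict (\<lambda>i. \<not> g B i) B} \<in> sign_patterns B"
      unfolding sign_patterns_def by blast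
  qed
  ultimately have x: "(P, \<sigma>) \<in> signed_partitions n"
    by (auto simp: signed_partitions_def)
  have "(s, i, j) \<in> rel_of (P, \<sigma>) \<longleftrightarrow> (s, i, j) \<in> R" for s i j
  proof (cases "i \<le> n \<and> j \<in> block R i")
    case False
    then have "(s, i, j) \<notin> R" using signed_equiv_bound[OF R] by (auto simp: block_def)
    moreover have "(s, i, j) \<notin> rel_of (P, \<sigma>)"
      using False P_block signed_partition_bound[OF x] by (auto simp: rel_of_def)
    ultimately show ?thesis by simp
  next
    case True
    let ?B = "block R i"
    have B: "?B \<in> P" "i \<in> ?B" using True blockP block_self[OF R] by auto
    from True obtain t where t: "(t, i, j) \<in> R" by (auto simp: block_def)
    show ?thesis
    proof (cases "0 \<in> ?B")
      case z: True
      then show ?thesis using both_signs[OF R t] rel_of_iff[OF x B] True by simp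
    next
      case z: False
      then have "?B \<in> signed_blocks P" using B by (simp add: signed_blocks_def)
      then have g: "g ?B \<in> \<sigma> ?B" by (simp add: \<sigma>_def)
      define b where "b = (SOME b. b \<in> ?B)"
      have b: "b \<in> ?B" unfolding b_def using B(2) by (rule someI)
      have bB: "block R b = ?B" using block_eq[OF R b] .
      obtain p where p: "(p, b, i) \<in> R" using b block_sym[OF R b] by (auto simp: block_def)
      have q: "(p = t, b, j) \<in> R" by (rule signed_equiv_trans[OF R p t])
      have "g ?B i = p"
        using B p signs_unique[OF R p, of True] z bB by (auto simp: g_def b_def[symmetric])
      moreover have "g ?B j = (p = t)"
        using True q signs_unique[OF R q, of True] z bB by (auto simp: g_def b_def[symmetric])
      ultimately have "(g ?B i = g ?B j) = t" by auto
      then have "(s, i, j) \<in> rel_of (P, \<sigma>) \<longleftrightarrow> t = s"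
        using rel_of_signed_iff[OF x B z g] True by simp
      moreover have "(s, i, j) \<in> R \<longleftrightarrow> t = s" using t signs_unique[OF R t, of s] z by blast
      ultimately show ?thesis by simp
    qed
  qed
  then have "rel_of (P, \<sigma>) = R" by auto
  then show ?thesis using x by blast
qed

section \<open>The order generated by covers as inclusion of relations\<close>

lemma rel_ofI:
  "\<lbrakk>B \<in> P; i \<in> B; j \<in> B; 0 \<in> B \<or> (\<exists>f \<in> \<sigma> B. (f i = f j) = s)\<rbrakk> \<Longrightarrow> (s, i, j) \<in> rel_of (P, \<sigma>)"
  unfolding rel_of_def mem_Collect_eq prod.case fst_conv snd_conv by (rule bexI[of _ B]) simp_all

lemma rel_ofE:
  assumes "(s, i, j) \<in> rel_of (P, \<sigma>)"
  obtains B where "B \<in> P" "i \<in> B" "j \<in> B" "0 \<in> B \<or> (\<exists>f \<in> \<sigma> B. (f i = f j) = s)"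
  using assms unfolding rel_of_def mem_Collect_eq prod.case fst_conv snd_conv
  by (elim bexE conjE)

text \<open>The new pattern \<open>p\<close> restricts to the old ones, so their relative signs
  persist; the enlarged zero block admits all signs.\<close>

lemma signed_cover_rel_of_mono:
  assumes "signed_cover x y" "x \<in> signed_partitions n"
  shows "rel_of x \<subseteq> rel_of y"
  using assms
proof (induction rule: signed_cover.induct)
  case (merge_signed A P B p \<sigma> Q)
  note x = merge_signed.prems
  have AB: "A \<in> P" "B \<in> P" "0 \<notin> A" "0 \<notin> B"
    using merge_signed.hyps by (auto simp: signed_blocks_def)
  have AQ: "A \<union> B \<in> signed_blocks Q"
    using AB merge_signed.hyps by (auto simp: signed_blocks_def)
  let ?y = "(Q, restrict (\<sigma>(A \<union> B := p)) (signed_blocks Q))"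
  have "(s, i, j) \<in> rel_of ?y" if "(s, i, j) \<in> rel_of (P, \<sigma>)" for s i j
  proof -
    from that obtain D where D: "D \<in> P" "i \<in> D" "j \<in> D"
      and sgn: "0 \<in> D \<or> (\<exists>f \<in> \<sigma> D. (f i = f j) = s)" by (rule rel_ofE)
    show ?thesis
    proof (cases "D = A \<or> D = B")
      case True
      then obtain f where f: "f \<in> \<sigma> D" "(f i = f j) = s" using AB sgn by blast
      have "\<sigma> D = restrict_pattern p D" using True merge_signed.hyps by auto
      then obtain g where g: "g \<in> p" "f = restrict g D" using f by (auto simp: restrict_pattern_def)
      have "(g i = g j) = s" using f g D by simp
      moreover have "i \<in> A \<union> B" "j \<in> A \<union> B" using D True by auto
      moreover have "A \<union> B \<in> Q" using AQ by (simp add: signed_blocks_def)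
      ultimately show ?thesis using AQ g(1) by (intro rel_ofI[of "A \<union> B"]) auto
    next
      case False
      then have DQ: "D \<in> Q" using D merge_signed.hyps by auto
      \<comment> \<open>A block equal to the union would meet \<open>A\<close> or \<open>B\<close>
        and so coincide with it. Hence the update at \<open>A \<union> B\<close> leaves the pattern
        of \<open>D\<close> alone.\<close>
      have "D \<noteq> A \<union> B"
        using False D signed_partition_same[OF x D(1) _ D(2)] AB by blast
      then have "0 \<in> D \<or> (\<exists>f \<in> restrict (\<sigma>(A \<union> B := p)) (signed_blocks Q) D. (f i = f j) = s)"
        using sgn DQ by (auto simp: signed_blocks_def)
      then show ?thesis by (rule rel_ofI[OF DQ D(2,3)])
    qed
  qed
  then show ?case by auto
next
  case (merge_zero Z P A Q \<sigma>)
  note x = merge_zero.prems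
  let ?y = "(Q, restrict \<sigma> (signed_blocks Q))"
  have "(s, i, j) \<in> rel_of ?y" if "(s, i, j) \<in> rel_of (P, \<sigma>)" for s i j
  proof -
    from that obtain D where D: "D \<in> P" "i \<in> D" "j \<in> D"
      and sgn: "0 \<in> D \<or> (\<exists>f \<in> \<sigma> D. (f i = f j) = s)" by (rule rel_ofE)
    show ?thesis
    proof (cases "D = A \<or> D = Z")
      case True
      then show ?thesis using D merge_zero.hyps by (intro rel_ofI[of "Z \<union> A"]) auto
    next
      case False
      then have DQ: "D \<in> Q" using D merge_zero.hyps by auto
      then have "0 \<in> D \<or> (\<exists>f \<in> restrict \<sigma> (signed_blocks Q) D. (f i = f j) = s)"
        using sgn by (auto simp: signed_blocks_def)
      then show ?thesis by (rule rel_ofI[OF DQ D(2,3)])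
    qed
  qed
  then show ?case by auto
qed

text \<open>A block \<open>C\<close> of \<open>Q\<close> that is no block of \<open>P\<close>
  contains at least two blocks of \<open>P\<close>. Two of them are merged: into the zero block if
  \<open>0\<close> lies in \<open>C\<close>, otherwise with the pattern that \<open>C\<close>
  induces. The falling number of blocks drives the induction along chains.\<close>

lemma signed_cover_below:
  assumes x: "(P, \<sigma>) \<in> signed_partitions n" and y: "(Q, \<tau>) \<in> signed_partitions n"
    and sub: "rel_of (P, \<sigma>) \<subseteq> rel_of (Q, \<tau>)" and ne: "P \<noteq> Q"
  shows "\<exists>P' \<sigma>'. signed_cover (P, \<sigma>) (P', \<sigma>') \<and> rel_of (P', \<sigma>') \<subseteq> rel_of (Q, \<tau>)
    \<and> card P' < card P"
proof -
  have refine: "A \<subseteq> C" if "A \<in> P" "C \<in> Q" "e \<in> A" "e \<in> C" for A C e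
    using block_mono[OF sub, of e] block_rel_of[OF x, of A e] block_rel_of[OF y, of C e] that by simp
  have Pblock: "\<exists>A \<in> P. e \<in> A" if "C \<in> Q" "e \<in> C" for C e
    using signed_partition_block[OF x signed_partition_bound[OF y that]] .
  have finP: "finite P"
    using signed_partition_partition_on[OF x] finite_elements[of "{0..n}"] by blast
  have card: "card (insert (A \<union> B) (P - {A, B})) < card P" if "A \<in> P" "B \<in> P" "A \<noteq> B" for A B
  proof -
    have "card {A, B} \<le> card P" using that finP by (intro card_mono) auto
    then have "Suc (card (P - {A, B})) < card P"
      using that finP by (simp add: card_Diff_subset)
    moreover have "card (insert (A \<union> B) (P - {A, B})) \<le> Suc (card (P - {A, B}))"
      using finP by (simp add: card_insert_if)
    ultimately show ?thesis by simp
  qed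
  \<comment> \<open>If all blocks of \<open>Q\<close> were blocks of \<open>P\<close>, they would be
    all of these, since they cover the ground set.\<close>
  have "\<exists>C \<in> Q. C \<notin> P"
  proof (rule ccontr)
    assume "\<not> ?thesis"
    then have QP: "Q \<subseteq> P" by blast
    have "A \<in> Q" if A: "A \<in> P" for A
    proof -
      obtain e where e: "e \<in> A"
        using partition_onD3[OF signed_partition_partition_on[OF x]] A by fastforce
      obtain C where C: "C \<in> Q" "e \<in> C"
        using signed_partition_block[OF y signed_partition_bound[OF x A e]] by blast
      then have "A = C" using signed_partition_same[OF x A _ e] QP by blast
      then show ?thesis using C by simp
    qed
    then show False using QP ne by blast
  qed
  then obtain C where C: "C \<in> Q" "C \<notin> P" by blast
  have other: "(s, i, j) \<in> rel_of (Q, \<tau>)"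
    if "D \<in> P" "i \<in> D" "j \<in> D" "0 \<in> D \<or> (\<exists>f \<in> \<sigma> D. (f i = f j) = s)" for s i j D
    using rel_ofI[of D P i j \<sigma> s] that sub by blast
  show ?thesis
  proof (cases "0 \<in> C")
    case True
    obtain Z where Z: "Z \<in> P" "0 \<in> Z" using signed_partition_block[OF x] by blast
    have ZC: "Z \<subseteq> C" using refine[OF Z(1) C(1) Z(2) True] .
    moreover have "Z \<noteq> C" using Z(1) C(2) by metis
    ultimately obtain e where e: "e \<in> C" "e \<notin> Z" by blast
    then obtain A where A: "A \<in> P" "e \<in> A" using Pblock[OF C(1)] by blast
    have AC: "A \<subseteq> C" using refine[OF A(1) C(1) A(2) e(1)] .
    have "A \<noteq> Z" using e A by blast
    then have "0 \<notin> A" using signed_partition_same[OF x A(1) Z(1) _ Z(2)] by blast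
    then have "A \<in> signed_blocks P" using A by (simp add: signed_blocks_def)
    define P' where "P' = insert (Z \<union> A) (P - {Z, A})"
    define \<sigma>' where "\<sigma>' = restrict \<sigma> (signed_blocks P')"
    have cov: "signed_cover (P, \<sigma>) (P', \<sigma>')"
      unfolding \<sigma>'_def by (rule merge_zero) (use Z \<open>A \<in> signed_blocks P\<close> P'_def in auto)
    have "(s, i, j) \<in> rel_of (Q, \<tau>)" if "(s, i, j) \<in> rel_of (P', \<sigma>')" for s i j
    proof -
      from that obtain D where D: "D \<in> P'" "i \<in> D" "j \<in> D"
        and sgn: "0 \<in> D \<or> (\<exists>f \<in> \<sigma>' D. (f i = f j) = s)" by (rule rel_ofE)
      show ?thesis
      proof (cases "D = Z \<union> A")
        case True
        then have "i \<in> C" "j \<in> C" using D AC ZC by auto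
        then show ?thesis using rel_of_iff[OF y C(1)] \<open>0 \<in> C\<close> by simp
      next
        case False
        then have "D \<in> P" using D by (auto simp: P'_def)
        moreover have "\<sigma>' D = \<sigma> D" if "0 \<notin> D"
          using that D(1) by (simp add: \<sigma>'_def signed_blocks_def)
        ultimately show ?thesis using other[OF _ D(2,3)] sgn by (cases "0 \<in> D") simp_all
      qed
    qed
    then have "rel_of (P', \<sigma>') \<subseteq> rel_of (Q, \<tau>)" by auto
    moreover have "card P' < card P" using card[OF Z(1) A(1)] \<open>A \<noteq> Z\<close> by (simp add: P'_def)
    ultimately show ?thesis using cov by (intro exI[of _ P'] exI[of _ \<sigma>']) simp
  next
    case False
    obtain c where "c \<in> C"
      using partition_onD3[OF signed_partition_partition_on[OF y]] C by fastforce
    then obtain A where A: "A \<in> P" "c \<in> A" using Pblock[OF C(1)] by blast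
    have AC: "A \<subseteq> C" using refine[OF A(1) C(1) A(2) \<open>c \<in> C\<close>] .
    moreover have "A \<noteq> C" using A(1) C(2) by metis
    ultimately obtain e where e: "e \<in> C" "e \<notin> A" by blast
    then obtain B where B: "B \<in> P" "e \<in> B" using Pblock[OF C(1)] by blast
    have BC: "B \<subseteq> C" using refine[OF B(1) C(1) B(2) e(1)] .
    have "A \<noteq> B" using e B by blast
    have AB: "A \<in> signed_blocks P" "B \<in> signed_blocks P"
      using A B AC BC False by (auto simp: signed_blocks_def)
    note pC = signed_partition_pattern[OF y C(1) False]
    obtain g where g: "g \<in> \<tau> C" using sign_patterns_nonempty[OF pC] by blast
    \<comment> \<open>Among the compatible patterns on the union, the one induced by
      \<open>\<tau> C\<close> keeps the merged partition below \<open>(Q, \<tau>)\<close>.\<close>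
    define p where "p = restrict_pattern (\<tau> C) (A \<union> B)"
    have p: "p \<in> sign_patterns (A \<union> B)"
      unfolding p_def using restrict_pattern_in_sign_patterns[OF pC] AC BC by simp
    \<comment> \<open>By \<open>sub\<close>, the relative signs of \<open>\<sigma> D\<close> are
      those of \<open>g\<close>, and they determine the pattern on \<open>D\<close>.\<close>
    have compat: "restrict_pattern p D = \<sigma> D" if D: "D \<in> P" "D \<subseteq> A \<union> B" "D \<subseteq> C" for D
    proof -
      have D0: "0 \<notin> D" using D False by blast
      note pD = signed_partition_pattern[OF x D(1) D0]
      obtain f where f: "f \<in> \<sigma> D" using sign_patterns_nonempty[OF pD] by blast
      have "restrict g D = restrict (restrict g (A \<union> B)) D"
        using D(2) by (auto simp: fun_eq_iff)
      then have gD: "restrict g D \<in> restrict_pattern p D"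
        using g unfolding p_def restrict_pattern_def by blast
      show ?thesis
      proof (rule sign_patterns_eqI[OF restrict_pattern_in_sign_patterns[OF p D(2)] gD pD f])
        fix i j assume ij: "i \<in> D" "j \<in> D"
        have "(f i = f j, i, j) \<in> rel_of (Q, \<tau>)"
          using sub rel_of_signed_iff[OF x D(1) ij(1) D0 f] ij by auto
        then have "(g i = g j) = (f i = f j)"
          using rel_of_signed_iff[OF y C(1) _ False g, of i] D ij by auto
        then show "(restrict g D i = restrict g D j) = (f i = f j)" using ij by simp
      qed
    qed
    define P' where "P' = insert (A \<union> B) (P - {A, B})"
    define \<sigma>' where "\<sigma>' = restrict (\<sigma>(A \<union> B := p)) (signed_blocks P')"
    have cov: "signed_cover (P, \<sigma>) (P', \<sigma>')"
      unfolding \<sigma>'_def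
      by (rule merge_signed)
        (use AB \<open>A \<noteq> B\<close> p compat[of A] compat[of B] A B AC BC P'_def in auto)
    have "(s, i, j) \<in> rel_of (Q, \<tau>)" if "(s, i, j) \<in> rel_of (P', \<sigma>')" for s i j
    proof -
      from that obtain D where D: "D \<in> P'" "i \<in> D" "j \<in> D"
        and sgn: "0 \<in> D \<or> (\<exists>f \<in> \<sigma>' D. (f i = f j) = s)" by (rule rel_ofE)
      show ?thesis
      proof (cases "D = A \<union> B")
        case True
        have "0 \<notin> D" using True AC BC False by blast
        then obtain f where f: "f \<in> \<sigma>' D" "(f i = f j) = s" using sgn by blast
        have "\<sigma>' D = p" using True \<open>0 \<notin> D\<close> D(1) by (simp add: \<sigma>'_def signed_blocks_def)
        then obtain g' where g': "g' \<in> \<tau> C" "f = restrict g' (A \<union> B)"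
          using f by (auto simp: p_def restrict_pattern_def)
        have "i \<in> C" "j \<in> C" using D True AC BC by auto
        then show ?thesis
          using rel_of_signed_iff[OF y C(1) _ False g'(1), of i s j] g' f D True by simp
      next
        case False
        then have "D \<in> P" using D by (auto simp: P'_def)
        moreover have "\<sigma>' D = \<sigma> D" if "0 \<notin> D"
          using that D(1) False by (simp add: \<sigma>'_def signed_blocks_def)
        ultimately show ?thesis using other[OF _ D(2,3)] sgn by (cases "0 \<in> D") simp_all
      qed
    qed
    then have "rel_of (P', \<sigma>') \<subseteq> rel_of (Q, \<tau>)" by auto
    moreover have "card P' < card P" using card[OF A(1) B(1) \<open>A \<noteq> B\<close>] by (simp add: P'_def)
    ultimately show ?thesis using cov by (intro exI[of _ P'] exI[of _ \<sigma>']) simp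
  qed
qed

text \<open>Covers only enlarge the relation. Conversely, covers that stay below \<open>y\<close>
  are applied until the blocks are those of \<open>y\<close>, and then the patterns agree as
  well.\<close>

lemma signed_cover_rtranclp_iff:
  assumes x: "x \<in> signed_partitions n" and y: "y \<in> signed_partitions n"
  shows "signed_cover\<^sup>*\<^sup>* x y \<longleftrightarrow> rel_of x \<subseteq> rel_of y"
proof
  assume "signed_cover\<^sup>*\<^sup>* x y"
  then have "y \<in> signed_partitions n \<and> rel_of x \<subseteq> rel_of y"
  proof induction
    case base
    then show ?case using x by simp
  next
    case (step y z)
    then show ?case using signed_cover_closed signed_cover_rel_of_mono by blast
  qed
  then show "rel_of x \<subseteq> rel_of y" by simp
next
  assume "rel_of x \<subseteq> rel_of y"
  then show "signed_cover\<^sup>*\<^sup>* x y"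
    using x
  proof (induction "card (fst x)" arbitrary: x rule: less_induct)
    case less
    obtain P \<sigma> Q \<tau> where xy: "x = (P, \<sigma>)" "y = (Q, \<tau>)" by (cases x, cases y)
    show ?case
    proof (cases "P = Q")
      case True
      then show ?thesis using rel_of_subset_same_blocks[of P \<sigma> n \<tau>] less.prems xy y by simp
    next
      case False
      obtain P' \<sigma>' where z: "signed_cover x (P', \<sigma>')" "rel_of (P', \<sigma>') \<subseteq> rel_of y"
        "card P' < card (fst x)"
        using signed_cover_below[of P \<sigma> n Q \<tau>] less.prems xy y False by auto
      have "signed_cover\<^sup>*\<^sup>* (P', \<sigma>') y"
        by (rule less.hyps) (use z signed_cover_closed[OF z(1) less.prems(2)] in auto)
      then show ?thesis using z(1) by (rule converse_rtranclp_into_rtranclp[rotated])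
    qed
  qed
qed

section \<open>The $k,h$-equal partitions and the conclusion\<close>

text \<open>Constraints on the block of each \<open>i\<close> and constraints on each block amount
  to the same, since every \<open>i\<close> lies in a block and no block is empty.\<close>

lemma carrier_signed_equal_partition_lattice:
  "carrier (signed_equal_partition_lattice n k h) =
     {x \<in> signed_partitions n. rel_of x \<in> equal_rels n k h}"
proof -
  have "(\<forall>B \<in> signed_blocks P. card B = 1 \<or> k \<le> card B) \<and>
      (\<forall>Z \<in> P. 0 \<in> Z \<longrightarrow> card Z = 1 \<or> h + 1 \<le> card Z) \<longleftrightarrow> rel_of (P, \<sigma>) \<in> equal_rels n k h"
    if x: "(P, \<sigma>) \<in> signed_partitions n" for P \<sigma>
  proof -
    let ?R = "rel_of (P, \<sigma>)"
    have eq: "block ?R i = {i} \<or> large k h ?R i \<longleftrightarrow>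
        card B = 1 \<or> (if 0 \<in> B then h + 1 else k) \<le> card B"
      if B: "B \<in> P" "i \<in> B" for B i
    proof -
      have "B = {i} \<longleftrightarrow> card B = 1" using B by (auto simp: card_1_singleton_iff)
      then show ?thesis using block_rel_of[OF x B] by (simp add: large_def)
    qed
    have "(\<forall>i\<le>n. block ?R i = {i} \<or> large k h ?R i) \<longleftrightarrow>
        (\<forall>B \<in> P. card B = 1 \<or> (if 0 \<in> B then h + 1 else k) \<le> card B)"
    proof
      assume L: "\<forall>i\<le>n. block ?R i = {i} \<or> large k h ?R i"
      show "\<forall>B \<in> P. card B = 1 \<or> (if 0 \<in> B then h + 1 else k) \<le> card B"
      proof
        fix B assume B: "B \<in> P"
        then obtain i where i: "i \<in> B"
          using partition_onD3[OF signed_partition_partition_on[OF x]] by fastforce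
        show "card B = 1 \<or> (if 0 \<in> B then h + 1 else k) \<le> card B"
          using eq[OF B i] L signed_partition_bound[OF x B i] by blast
      qed
    next
      assume "\<forall>B \<in> P. card B = 1 \<or> (if 0 \<in> B then h + 1 else k) \<le> card B"
      then show "\<forall>i\<le>n. block ?R i = {i} \<or> large k h ?R i"
        using eq signed_partition_block[OF x] by meson
    qed
    then show ?thesis using signed_equiv_rel_of[OF x]
      by (auto simp: equal_rels_def signed_blocks_def)
  qed
  then show ?thesis
    by (auto simp: signed_equal_partition_lattice_def)
qed

theorem theorem6p2:
  fixes n k h :: nat
  assumes "1 \<le> h" and "h < k" and "k \<le> n"
  shows "comodernistic (signed_equal_partition_lattice n k h)"
proof (rule comodernistic_set_family)
  let ?L = "signed_equal_partition_lattice n k h"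
  note carr = carrier_signed_equal_partition_lattice[of n k h]
  show "eq ?L = (=)"
    by (simp add: signed_equal_partition_lattice_def signed_partition_lattice_def)
  show "bij_betw rel_of (carrier ?L) (equal_rels n k h)"
    unfolding bij_betw_def
  proof
    show "inj_on rel_of (carrier ?L)"
      using inj_on_rel_of by (rule inj_on_subset) (auto simp: carr)
    show "rel_of ` carrier ?L = equal_rels n k h"
    proof (intro equalityI subsetI)
      fix R assume R: "R \<in> equal_rels n k h"
      then obtain x where "x \<in> signed_partitions n" "rel_of x = R"
        using rel_of_surj[of n R] by (auto simp: equal_rels_def)
      then show "R \<in> rel_of ` carrier ?L" using R by (auto simp: carr)
    qed (auto simp: carr)
  qed
  show "x \<sqsubseteq>\<^bsub>?L\<^esub> y \<longleftrightarrow> rel_of x \<subseteq> rel_of y" if "x \<in> carrier ?L" "y \<in> carrier ?L" for x y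
    using signed_cover_rtranclp_iff[of x n y] that
    by (simp add: carr) (simp add: signed_equal_partition_lattice_def signed_partition_lattice_def)
  show "UNIV \<times> {0..n} \<times> {0..n} \<in> equal_rels n k h"
    by (rule equal_rels_top[OF assms(2,3)])
  show "S \<subseteq> UNIV \<times> {0..n} \<times> {0..n}" if "S \<in> equal_rels n k h" for S
    using that by (auto simp: equal_rels_def dest: signed_equiv_bound)
qed (rule equal_rels_Inf[OF assms(2)], assumption+,
    rule equal_rels_modular_coatom[OF assms(2)], assumption+)

end
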